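(* Let $q=p^h$ be a prime power ($p$ prime) and $n\ge 2$ an integer such that $q\geq n+3$ or $q=p=n+2$; suppose moreover that either $n\geq 3$, or $n=2$ and $q$ is odd. Let $\mathcal{K}$ be an arc of size $q$ in $H_\infty=\mathrm{PG}(n,q)$. Then $\mathrm{Aut}(\Gamma_{n,q}(\mathcal{K}))\cong \mathrm{P\Gamma L}(n+2,q)_{\mathcal{K}}$.
   Context: A $k$-arc in $\mathrm{PG}(n,q)$ is a set of $k\ge n+1$ points such that no $n+1$ of them lie in a hyperplane. Embed $H_\infty=\mathrm{PG}(n,q)$ as a hyperplane in $\mathrm{PG}(n+1,q)$; points of $\mathrm{PG}(n+1,q)\setminus H_\infty$ are called affine. For a point set $\mathcal{K}$ of $H_\infty$, $\Gamma_{n,q}(\mathcal{K})$ is the bipartite graph whose vertex classes are $\mathcal{P}$, the set of affine points, and $\mathcal{L}$, the set of lines of $\mathrm{PG}(n+1,q)$ that are not contained in $H_\infty$ and pass through a point of $\mathcal{K}$; adjacency is incidence. $\mathrm{Aut}$ denotes the full graph automorphism group (automorphisms may interchange the two classes). $\mathrm{P\Gamma L}(n+2,q)_{\mathcal{K}}$ is the setwise stabiliser of $\mathcal{K}$ in the collineation group $\mathrm{P\Gamma L}(n+2,q)$ of $\mathrm{PG}(n+1,q)$ (it stabilises $H_\infty$, since $\mathcal{K}$ spans $H_\infty$). *)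

theory Defs
  imports "HOL-Analysis.Cartesian_Space" "HOL-Algebra.Bij"
          "HOL-Computational_Algebra.Primes"
begin

section \<open>Projective geometry\<close>

text \<open>
  The underlying vector space of \<open>PG(m, q)\<close> is \<open>'a ^ 'd\<close> with \<open>'a\<close> a field of \<open>q\<close> elements and
  \<open>CARD('d) = m + 1\<close>. A projective subspace is identified with the linear subspace of \<open>'a ^ 'd\<close>
  that carries it, so projective dimension is linear dimension minus one and incidence is
  inclusion. A linear subspace \<open>U\<close> is also regarded as a projective space in its own right.
\<close>

definition pg_points :: "('a::field ^ 'd::finite) set \<Rightarrow> ('a ^ 'd) set set" where
  "pg_points U = {P. vec.subspace P \<and> P \<subseteq> U \<and> vec.dim P = 1}"

definition pg_lines :: "('a::field ^ 'd::finite) set \<Rightarrow> ('a ^ 'd) set set" where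
  "pg_lines U = {L. vec.subspace L \<and> L \<subseteq> U \<and> vec.dim L = 2}"

definition pg_hyperplanes :: "('a::field ^ 'd::finite) set \<Rightarrow> ('a ^ 'd) set set" where
  "pg_hyperplanes U = {W. vec.subspace W \<and> W \<subseteq> U \<and> vec.dim W + 1 = vec.dim U}"

text \<open>
  Arcs of the projective space carried by \<open>U\<close>. For \<open>U = PG(n, q)\<close> the linear dimension
  \<open>vec.dim U\<close> is the number \<open>n + 1\<close> of the usual definition.
\<close>

definition pg_arc :: "('a::field ^ 'd::finite) set \<Rightarrow> ('a ^ 'd) set set \<Rightarrow> bool" where
  "pg_arc U K \<longleftrightarrow>
     K \<subseteq> pg_points U \<and> finite K \<and> vec.dim U \<le> card K \<and>
     (\<forall>S \<subseteq> K. card S = vec.dim U \<longrightarrow> \<not> (\<exists>W \<in> pg_hyperplanes U. \<forall>P \<in> S. P \<subseteq> W))"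

section \<open>The collineation group\<close>

definition field_aut :: "('a::field \<Rightarrow> 'a) \<Rightarrow> bool" where
  "field_aut \<sigma> \<longleftrightarrow>
     bij \<sigma> \<and> (\<forall>x y. \<sigma> (x + y) = \<sigma> x + \<sigma> y) \<and> (\<forall>x y. \<sigma> (x * y) = \<sigma> x * \<sigma> y)"

definition semilinear_bij :: "('a::field \<Rightarrow> 'a) \<Rightarrow> ('a ^ 'd::finite \<Rightarrow> 'a ^ 'd) \<Rightarrow> bool" where
  "semilinear_bij \<sigma> f \<longleftrightarrow>
     field_aut \<sigma> \<and> bij f \<and> (\<forall>x y. f (x + y) = f x + f y) \<and> (\<forall>c x. f (c *s x) = \<sigma> c *s f x)"

text \<open>
  The group \<open>P\<Gamma>L\<close> in its action on the points of the projective space: the permutations of the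
  points induced by bijective semilinear maps, so that maps differing by a scalar are identified.
  The permutations are extensional functions, undefined outside the set of points.
\<close>

definition PGammaL :: "(('a::field ^ 'd::finite) set \<Rightarrow> ('a ^ 'd) set) monoid" where
  "PGammaL = (BijGroup (pg_points UNIV))
     \<lparr>carrier := {\<lambda>P \<in> pg_points UNIV. f ` P | f. \<exists>\<sigma>. semilinear_bij \<sigma> f}\<rparr>"

definition PGammaL_stabiliser ::
  "('a::field ^ 'd::finite) set set \<Rightarrow> (('a ^ 'd) set \<Rightarrow> ('a ^ 'd) set) monoid" where
  "PGammaL_stabiliser K = PGammaL \<lparr>carrier := {g \<in> carrier PGammaL. g ` K = K}\<rparr>"

section \<open>Graphs and their automorphism groups\<close>

text \<open>
  A simple graph is a pair of a vertex set and a set of edges, each edge being a set of two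
  vertices.
\<close>

type_synonym 'v sgraph = "'v set \<times> 'v set set"

definition graph_Aut :: "'v sgraph \<Rightarrow> ('v \<Rightarrow> 'v) monoid" where
  "graph_Aut G = (BijGroup (fst G))
     \<lparr>carrier := {f \<in> Bij (fst G).
        \<forall>u \<in> fst G. \<forall>v \<in> fst G. {f u, f v} \<in> snd G \<longleftrightarrow> {u, v} \<in> snd G}\<rparr>"

section \<open>The linear representation graph\<close>

definition affine_points :: "('a::field ^ 'd::finite) set \<Rightarrow> ('a ^ 'd) set set" where
  "affine_points H = pg_points UNIV - pg_points H"

definition rep_lines ::
  "('a::field ^ 'd::finite) set \<Rightarrow> ('a ^ 'd) set set \<Rightarrow> ('a ^ 'd) set set" where
  "rep_lines H K = {L \<in> pg_lines UNIV. \<not> L \<subseteq> H \<and> (\<exists>P \<in> K. P \<subseteq> L)}"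

text \<open>
  The two vertex classes are disjoint, since their members have linear dimension 1 and 2.
\<close>

definition Gamma_graph ::
  "('a::field ^ 'd::finite) set \<Rightarrow> ('a ^ 'd) set set \<Rightarrow> ('a ^ 'd) set sgraph" where
  "Gamma_graph H K =
     (affine_points H \<union> rep_lines H K,
      {{P, L} | P L. P \<in> affine_points H \<and> L \<in> rep_lines H K \<and> P \<subseteq> L})"

end

(*
  Fix v0 outside H and spanning vectors D of the points of K. The affine points are the spans of
  v0 + w with w in H, and the lines of the graph become the translates of the lines spanned by D.

  Call two vertices u, v far if they have no common neighbour, but every neighbour of u is at
  distance at most two from a neighbour of v. Two lines that are far are parallel: otherwise
  the q points of the first would use q distinct directions of transversals among the q - 2
  remaining ones. Conversely, the translates of a line by a multiple of another direction are far
  from it. Two affine points x, y are never far: every direction d would lie in a plane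
  containing y - x and a second direction e, which is impossible if any four directions are
  independent, while for n = 2 the map d -> e would be an involution without fixed points on a set
  of odd size q. So an automorphism preserves the two classes and parallelism.

  A map of H that sends parallel lines to parallel lines is additive up to a translation, since
  D minus any one direction still spans H. The scalars with respect to which it is semilinear form
  an additive group S that contains all ratios of the coordinates of the points of K in a frame
  taken from K. If q is prime, S is everything because it contains 1. Otherwise, counting these
  ratios at one point, and at all points for a fixed pair of coordinates, gives card S >= n + 2
  and card S >= q - n, while a proper subgroup has at most q / 2 elements.
*)

theory Submission
  imports Defs "HOL-Number_Theory.Residues"
begin

section \<open>Additive subgroups of finite fields and involutions\<close>

text \<open>The pairs \<open>{x, f x}\<close> partition \<open>X\<close> into blocks of size two.
  This excludes a fixed-point-free involution on the directions when their number is odd.\<close>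

lemma even_card_if_involution:
  assumes "finite X" "\<And>x. x \<in> X \<Longrightarrow> f x \<in> X" "\<And>x. x \<in> X \<Longrightarrow> f x \<noteq> x"
    "\<And>x. x \<in> X \<Longrightarrow> f (f x) = x"
  shows "even (card X)"
proof -
  let ?C = "(\<lambda>x. {x, f x}) ` X"
  have U: "\<Union> ?C = X"
    using assms(2) by auto
  have "2 * card ?C = card (\<Union> ?C)"
  proof (rule card_partition)
    show "finite ?C" "finite (\<Union> ?C)"
      using assms(1) U by auto
    show "card c = 2" if "c \<in> ?C" for c
      using that assms(3) by (fastforce simp: card_2_iff)
    show "c1 \<inter> c2 = {}" if c: "c1 \<in> ?C" "c2 \<in> ?C" "c1 \<noteq> c2" for c1 c2
    proof -
      \<comment> \<open>A block is determined by any of its elements, so two blocks that meet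
        coincide.\<close>
      have *: "{z, f z} = C" if C: "C \<in> ?C" "z \<in> C" for z C
      proof -
        obtain x where x: "x \<in> X" "C = {x, f x}"
          using C(1) by blast
        then show ?thesis
          using C(2) assms(4)[OF x(1)] by (cases "z = x") (simp_all add: insert_commute)
      qed
      show ?thesis
        using c(3) *[OF c(1)] *[OF c(2)] by (metis disjoint_iff)
    qed
  qed
  then show ?thesis
    using U by (metis dvd_triv_left)
qed

text \<open>A proper additive subgroup has a disjoint translate.\<close>

lemma additive_subgroup_eq_UNIV:
  fixes S :: "'a::{ab_group_add, finite} set"
  assumes "\<And>x y. x \<in> S \<Longrightarrow> y \<in> S \<Longrightarrow> x - y \<in> S" and "CARD('a) < 2 * card S"
  shows "S = UNIV"
proof (rule ccontr)
  assume "S \<noteq> UNIV"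
  then obtain c where c: "c \<notin> S" by blast
  have "S \<inter> (+) c ` S = {}"
  proof (rule ccontr)
    assume "S \<inter> (+) c ` S \<noteq> {}"
    then obtain s where "c + s \<in> S" "s \<in> S" by blast
    then show False using assms(1)[of "c + s" s] c by simp
  qed
  then have "card (S \<union> (+) c ` S) = 2 * card S"
    by (simp add: card_Un_disjoint card_image)
  moreover have "card (S \<union> (+) c ` S) \<le> CARD('a)"
    by (rule card_mono) auto
  ultimately show False using assms(2) by simp
qed

text \<open>The characteristic equals the order of the field, so the multiples of 1 already exhaust
  it.\<close>

lemma additive_closed_prime_card_eq_UNIV:
  fixes S :: "'a::{field, finite} set"
  assumes "0 \<in> S" "1 \<in> S" "\<And>x y. x \<in> S \<Longrightarrow> y \<in> S \<Longrightarrow> x + y \<in> S" and "prime CARD('a)"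
  shows "S = UNIV"
proof -
  have "CHAR('a) = CARD('a)"
    using CHAR_dvd_CARD[where 'a = 'a] assms(4) by (metis CHAR_not_1' One_nat_def prime_nat_iff)
  then have "inj_on (of_nat :: nat \<Rightarrow> 'a) {..<CARD('a)}"
    by (auto intro!: inj_onI simp: of_nat_eq_iff_cong_CHAR cong_def)
  then have "card (of_nat ` {..<CARD('a)} :: 'a set) = CARD('a)"
    by (simp add: card_image)
  then have surj: "of_nat ` {..<CARD('a)} = (UNIV :: 'a set)"
    by (intro card_subset_eq) auto
  have "of_nat k \<in> S" for k
    by (induction k) (auto simp: assms)
  then have "of_nat ` {..<CARD('a)} \<subseteq> S"
    by auto
  then show ?thesis
    using surj by auto
qed

section \<open>Maps that preserve the parallelism of an arc\<close>

text \<open>\<open>H\<close> is the vector space of the hyperplane at infinity, so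
  \<open>vec.dim H\<close> stands for n + 1, and \<open>D\<close> for a choice of one spanning
  vector per point of the arc. In these terms \<open>dim_less\<close> reads n + 1 < q: outside any
  basis taken from \<open>D\<close> there is a further direction.\<close>

locale affine_arc =
  fixes H D :: "('a::{field,finite} ^ 'd::finite) set"
  assumes subspace_H: "vec.subspace H"
    and D_subset: "D \<subseteq> H"
    and card_D: "card D = CARD('a)"
    and dim_less: "vec.dim H < card D"
    and dim_ge: "3 \<le> vec.dim H"
    and arc: "\<And>T. T \<subseteq> D \<Longrightarrow> card T = vec.dim H \<Longrightarrow> vec.independent T"
begin

section \<open>Independence, coordinates and minors of the directions\<close>

lemma H_add: "x \<in> H \<Longrightarrow> y \<in> H \<Longrightarrow> x + y \<in> H"
  and H_diff: "x \<in> H \<Longrightarrow> y \<in> H \<Longrightarrow> x - y \<in> H"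
  and H_scale: "x \<in> H \<Longrightarrow> c *s x \<in> H"
  and H_zero: "0 \<in> H"
  using subspace_H
  by (auto intro: vec.subspace_add vec.subspace_diff vec.subspace_scale vec.subspace_0)

lemma D_H: "d \<in> D \<Longrightarrow> d \<in> H"
  using D_subset by blast

lemma independent_if_card_le:
  assumes "T \<subseteq> D" "card T \<le> vec.dim H"
  shows "vec.independent T"
proof -
  obtain B where "T \<subseteq> B" "B \<subseteq> D" "card B = vec.dim H"
    using exists_subset_between[of T "vec.dim H" D] assms dim_less by auto
  then show ?thesis
    using arc vec.independent_mono by blast
qed

lemma span_eq:
  assumes "T \<subseteq> D" "vec.dim H \<le> card T"
  shows "vec.span T = H"
proof -
  obtain B where B: "B \<subseteq> T" "card B = vec.dim H"
    using obtain_subset_with_card_n[OF assms(2)] by metis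
  then have "H \<subseteq> vec.span B"
    using vec.card_eq_dim[of B H] arc[of B] assms D_subset by auto
  then have "H \<subseteq> vec.span T"
    using vec.span_mono[OF B(1)] by blast
  moreover have "vec.span T \<subseteq> H"
    using assms(1) D_subset vec.span_minimal[OF _ subspace_H] by blast
  ultimately show ?thesis by blast
qed

lemma coeff_zero:
  assumes "T \<subseteq> D" "card T \<le> vec.dim H" "(\<Sum>d\<in>T. c d *s d) = 0" "d \<in> T"
  shows "c d = 0"
  using vec.independentD[OF independent_if_card_le[OF assms(1,2)], of T c d] assms(3,4) by simp

lemma nonzero: "d \<in> D \<Longrightarrow> d \<noteq> 0"
  using independent_if_card_le[of "{d}"] dim_ge by auto

lemma scale_eq_zero: "d \<in> D \<Longrightarrow> c *s d = 0 \<longleftrightarrow> c = 0"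
  using nonzero by (simp add: vec.scale_eq_0_iff)

lemma scale_cancel: "d \<in> D \<Longrightarrow> a *s d = b *s d \<longleftrightarrow> a = b"
  using nonzero by (simp add: vec.scale_cancel_right)

text \<open>This lemma and the next two make \<open>coeff_zero\<close> usable for relations written
  out term by term. Two or three directions are independent because of \<open>dim_ge\<close>; four
  require dimension at least 4, which is the case n >= 3.\<close>

lemma coeff_zero3:
  assumes "d \<in> D" "e \<in> D" "f \<in> D" "d \<noteq> e" "d \<noteq> f" "e \<noteq> f"
    and "a *s d + b *s e + c *s f = 0"
  shows "a = 0" "b = 0" "c = 0"
proof -
  let ?c = "\<lambda>x. if x = d then a else if x = e then b else c"
  have s: "(\<Sum>x\<in>{d, e, f}. ?c x *s x) = 0"
    using assms(4-7) by (simp add: add.assoc)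
  have *: "?c x = 0" if "x \<in> {d, e, f}" for x
    by (rule coeff_zero[OF _ _ s that]) (use assms(1-6) dim_ge in \<open>auto simp: card_insert_if\<close>)
  show "a = 0" "b = 0" "c = 0"
    using *[of d] *[of e] *[of f] assms(4-6) by simp_all
qed

lemma coeff_zero2:
  assumes "d \<in> D" "e \<in> D" "d \<noteq> e" "a *s d + b *s e = 0"
  shows "a = 0" "b = 0"
proof -
  let ?c = "\<lambda>x. if x = d then a else b"
  have s: "(\<Sum>x\<in>{d, e}. ?c x *s x) = 0"
    using assms(3,4) by simp
  have *: "?c x = 0" if "x \<in> {d, e}" for x
    by (rule coeff_zero[OF _ _ s that]) (use assms(1-3) dim_ge in \<open>auto simp: card_insert_if\<close>)
  show "a = 0" "b = 0"
    using *[of d] *[of e] assms(3) by simp_all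
qed

lemma coeff_zero4:
  assumes "4 \<le> vec.dim H" "d \<in> D" "e \<in> D" "f \<in> D" "g \<in> D" "distinct [d, e, f, g]"
    and "a *s d + b *s e + c *s f + r *s g = 0"
  shows "a = 0" "b = 0" "c = 0" "r = 0"
proof -
  let ?c = "\<lambda>x. if x = d then a else if x = e then b else if x = f then c else r"
  have s: "(\<Sum>x\<in>{d, e, f, g}. ?c x *s x) = 0"
  proof -
    have "e \<noteq> d" "f \<noteq> d" "g \<noteq> d" "f \<noteq> e" "g \<noteq> e" "g \<noteq> f"
      using assms(6) by auto
    then show ?thesis
      using assms(6,7) by (simp add: add.assoc)
  qed
  have *: "?c x = 0" if "x \<in> {d, e, f, g}" for x
    by (rule coeff_zero[OF _ _ s that]) (use assms(1-6) in \<open>auto simp: card_insert_if\<close>)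
  show "a = 0" "b = 0" "c = 0" "r = 0"
    using *[of d] *[of e] *[of f] *[of g] assms(6) by (simp_all split: if_splits)
qed

lemma coord_exists:
  assumes "B \<subseteq> D" "card B = vec.dim H" "x \<in> H"
  shows "\<exists>c. x = (\<Sum>b\<in>B. c b *s b)"
proof -
  have "x \<in> vec.span B"
    using span_eq[of B] assms by simp
  then show ?thesis
    using vec.span_finite[of B] by auto
qed

text \<open>If the coordinate at \<open>b\<close> vanished, \<open>f\<close> would be a combination
  of \<open>B - {b}\<close>, and this would be a linear relation among \<open>vec.dim H\<close>
  members of \<open>D\<close>.\<close>

lemma coord_nonzero:
  assumes B: "B \<subseteq> D" "card B = vec.dim H" and f: "f \<in> D - B"
    and c: "f = (\<Sum>b\<in>B. c b *s b)" and b: "b \<in> B"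
  shows "c b \<noteq> 0"
proof
  assume 0: "c b = 0"
  let ?T = "insert f (B - {b})"
  have fB: "f \<notin> B - {b}" "?T \<subseteq> D"
    using f B(1) by auto
  have "card ?T = card B"
    using fB(1) card_Suc_Diff1[OF _ b] by simp
  moreover have "(\<Sum>x\<in>?T. (if x = f then -1 else c x) *s x) = 0"
  proof -
    have "(\<Sum>x\<in>B - {b}. (if x = f then -1 else c x) *s x) = (\<Sum>x\<in>B - {b}. c x *s x)"
      using fB by (intro sum.cong) auto
    also have "\<dots> = f"
      using c b 0 by (simp add: sum.remove[of B b])
    finally show ?thesis
      using fB by simp
  qed
  ultimately show False
    using coeff_zero[of ?T "\<lambda>x. if x = f then -1 else c x" f] B fB(2) by simp
qed

text \<open>In effect, the 2 by 2 minors of the coordinates of vectors in \<open>D - B\<close> are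
  nonzero: if \<open>r *s f + r' *s f'\<close> has no component at \<open>b\<close> and
  \<open>b'\<close>, then \<open>f\<close>, \<open>f'\<close> and the rest of \<open>B\<close> are
  \<open>vec.dim H\<close> members of \<open>D\<close> in a relation with coefficient
  \<open>r\<close> at \<open>f\<close>.\<close>

lemma coord_pair:
  assumes B: "B \<subseteq> D" "card B = vec.dim H" and f: "f \<in> D - B" "f' \<in> D - B" "f \<noteq> f'"
    and c: "f = (\<Sum>b\<in>B. c b *s b)" "f' = (\<Sum>b\<in>B. c' b *s b)"
    and b: "b \<in> B" "b' \<in> B" "b \<noteq> b'"
    and r: "r * c b + r' * c' b = 0" "r * c b' + r' * c' b' = 0"
  shows "r = 0"
proof -
  let ?B = "B - {b, b'}"
  let ?T = "insert f (insert f' ?B)"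
  \<comment> \<open>On the remaining basis vectors the coefficients cancel the coordinates of
    \<open>r *s f + r' *s f'\<close>.\<close>
  let ?u = "\<lambda>x. if x = f then r else if x = f' then r' else - (r * c x + r' * c' x)"
  have fB: "f \<notin> ?B" "f' \<notin> ?B" "?T \<subseteq> D"
    using f B(1) by auto
  have "card ?B = card B - 2"
    using b by (simp add: card_Diff_subset)
  then have "card ?T = card B"
    using fB f(3) B(2) dim_ge by simp
  moreover have "(\<Sum>x\<in>?T. ?u x *s x) = 0"
  proof -
    have "(\<Sum>x\<in>?B. ?u x *s x) = (\<Sum>x\<in>?B. - ((r * c x + r' * c' x) *s x))"
      using fB
      by (intro sum.cong) (auto simp: vec.scale_left_diff_distrib vector_sadd_rdistrib)
    also have "\<dots> = - (\<Sum>x\<in>?B. (r * c x + r' * c' x) *s x)"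
      by (rule sum_negf)
    also have "(\<Sum>x\<in>?B. (r * c x + r' * c' x) *s x) = (\<Sum>x\<in>B. (r * c x + r' * c' x) *s x)"
      by (rule sum.mono_neutral_left) (use r in auto)
    also have "\<dots> = r *s f + r' *s f'"
      by (subst c(1), subst c(2))
        (simp add: vec.scale_sum_right vector_sadd_rdistrib sum.distrib vector_smult_assoc)
    finally show ?thesis
      using fB f(3) by simp
  qed
  ultimately show ?thesis
    using coeff_zero[of ?T ?u f] B fB(3) by simp
qed

section \<open>From additivity to semilinearity\<close>

text \<open>On the line spanned by a direction \<open>d\<close> the map acts through a scalar
  function \<open>s d\<close>. In a frame consisting of a basis \<open>B\<close> and a unit point
  \<open>e0\<close> these functions, for \<open>d\<close> in \<open>B\<close>, are rescalings of a
  single one, and each further point of the arc yields multipliers with which that function is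
  compatible.\<close>

lemma semilinear_if_additive:
  assumes g_add: "\<And>x y. x \<in> H \<Longrightarrow> y \<in> H \<Longrightarrow> g (x + y) = g x + g y"
    and g_inj: "\<And>x. x \<in> H \<Longrightarrow> g x = 0 \<Longrightarrow> x = 0"
    and g_dir: "\<And>d t. d \<in> D \<Longrightarrow> \<exists>s. g (t *s d) = s *s g d"
    and g_indep: "\<And>T c d. T \<subseteq> D \<Longrightarrow> card T = vec.dim H \<Longrightarrow> (\<Sum>d\<in>T. c d *s g d) = 0
      \<Longrightarrow> d \<in> T \<Longrightarrow> c d = 0"
    and large: "prime CARD('a) \<or> vec.dim H + 2 \<le> CARD('a)"
  shows "\<exists>\<sigma>. field_aut \<sigma> \<and> (\<forall>c. \<forall>x\<in>H. g (c *s x) = \<sigma> c *s g x)"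
proof -
  have g_0: "g 0 = 0"
    using g_add[of 0 0] H_zero by simp
  have g_diff: "g (x - y) = g x - g y" if "x \<in> H" "y \<in> H" for x y
    using g_add[of "x - y" y] that H_diff by (simp add: algebra_simps)
  have sum_H: "sum u T \<in> H" if "\<And>x. x \<in> T \<Longrightarrow> u x \<in> H" for u :: "'a ^ 'd \<Rightarrow> 'a ^ 'd" and T
    using vec.subspace_sum[OF subspace_H] that by blast
  have g_sum: "g (sum u T) = (\<Sum>x\<in>T. g (u x))" if "finite T" "\<And>x. x \<in> T \<Longrightarrow> u x \<in> H"
    for u :: "'a ^ 'd \<Rightarrow> 'a ^ 'd" and T
    using that
  proof (induction T rule: finite_induct)
    case empty
    then show ?case by (simp add: g_0)
  next
    case (insert x F)
    have "g (u x + sum u F) = g (u x) + g (sum u F)"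
      by (intro g_add sum_H) (use insert in auto)
    then show ?case using insert by simp
  qed
  have gd: "g d \<noteq> 0" if "d \<in> D" for d
    using g_inj[of d] that nonzero D_H by blast
  define s where "s = (\<lambda>d t. SOME s. g (t *s d) = s *s g d)"
  have s: "g (t *s d) = s d t *s g d" if "d \<in> D" for d t
    unfolding s_def using someI_ex[OF g_dir[OF that]] .
  have s_0: "s d t \<noteq> 0" if "d \<in> D" "t \<noteq> 0" for d t
  proof
    assume "s d t = 0"
    then have "g (t *s d) = 0" using s that by simp
    then show False
      using g_inj[of "t *s d"] that D_H H_scale scale_eq_zero by blast
  qed
  \<comment> \<open>\<open>B\<close> and the vector \<open>e0\<close> chosen below form the
    frame.\<close>
  obtain B where B: "B \<subseteq> D" "card B = vec.dim H"
    using obtain_subset_with_card_n[of "vec.dim H" D] dim_less by (metis less_imp_le)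
  have BD: "b \<in> D" if "b \<in> B" for b
    using B(1) that by blast
  have BH: "t *s b \<in> H" if "b \<in> B" for b t
    using B(1) that D_H H_scale by blast
  obtain e0 where e0: "e0 \<in> D - B"
    using B dim_less by (metis DiffI card_mono finite_code leD subsetI)
  have g_coord: "g (\<Sum>b\<in>B. c b *s b) = (\<Sum>b\<in>B. s b (c b) *s g b)" for c
  proof -
    have "g (\<Sum>b\<in>B. c b *s b) = (\<Sum>b\<in>B. g (c b *s b))"
      by (rule g_sum) (auto intro: BH)
    also have "\<dots> = (\<Sum>b\<in>B. s b (c b) *s g b)"
      by (rule sum.cong) (auto simp: s BD)
    finally show ?thesis .
  qed
  \<comment> \<open>The image of \<open>t *s f\<close> is computed in two ways, as
    \<open>s f t *s g f\<close> and coordinate by coordinate over \<open>B\<close>. The images of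
    \<open>B\<close> are independent, so the coefficients agree.\<close>
  have s_rel: "s b (t * c b) = s f t * s b (c b)"
    if f: "f \<in> D" "f = (\<Sum>b\<in>B. c b *s b)" and b: "b \<in> B" for f c b t
  proof -
    have "t *s f = (\<Sum>b\<in>B. (t * c b) *s b)"
      by (subst f(2)) (simp add: vec.scale_sum_right vector_smult_assoc)
    then have "s f t *s g f = (\<Sum>b\<in>B. s b (t * c b) *s g b)"
      using g_coord[of "\<lambda>b. t * c b"] s[OF f(1), of t] by metis
    moreover have "g f = (\<Sum>b\<in>B. s b (c b) *s g b)"
      using g_coord[of c] f(2) by simp
    ultimately have "(\<Sum>b\<in>B. (s b (t * c b) - s f t * s b (c b)) *s g b) = 0"
      by (simp add: vec.scale_sum_right vector_smult_assoc vec.scale_left_diff_distrib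
          sum_subtractf)
    then show ?thesis
      using g_indep[OF B _ b, of "\<lambda>b. s b (t * c b) - s f t * s b (c b)"] by simp
  qed
  obtain a where a: "e0 = (\<Sum>b\<in>B. a b *s b)"
    using coord_exists[OF B] e0 D_H by blast
  have a_0: "a b \<noteq> 0" if "b \<in> B" for b
    using coord_nonzero[OF B e0 a that] .
  \<comment> \<open>By \<open>s_rel\<close> for the unit point, every \<open>s b\<close> with
    \<open>b\<close> in \<open>B\<close> is \<open>\<tau>\<close> with argument and value
    rescaled.\<close>
  define \<tau> where "\<tau> = s e0"
  have s_\<tau>: "s b t = \<tau> (t / a b) * s b (a b)" if "b \<in> B" for b t
    using s_rel[OF _ a that, of "t / a b"] e0 a_0[OF that] by (simp add: \<tau>_def)
  have \<tau>_0: "\<tau> t \<noteq> 0" if "t \<noteq> 0" for t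
    using s_0[of e0 t] e0 that by (simp add: \<tau>_def)
  \<comment> \<open>The scalars with respect to which \<open>g\<close> is semilinear.
    \<open>S\<close> is closed under differences, so it suffices to show that it is large.\<close>
  define S where "S = {c. \<exists>c'. \<forall>x\<in>H. g (c *s x) = c' *s g x}"
  \<comment> \<open>Membership in \<open>S\<close> can be tested on \<open>\<tau>\<close> alone,
    since the rescalings do not interfere with multiplication by \<open>c\<close>.\<close>
  have S_I: "c \<in> S" if c: "\<And>t. \<tau> (c * t) = c' * \<tau> t" for c c'
  proof -
    have "s b (c * t) = c' * s b t" if "b \<in> B" for b t
      using c[of "t / a b"] s_\<tau>[OF that, of t] s_\<tau>[OF that, of "c * t"] by simp
    then have "g (c *s x) = c' *s g x" if x: "x \<in> H" for x
    proof -
      obtain u where u: "x = (\<Sum>b\<in>B. u b *s b)"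
        using coord_exists[OF B x] by blast
      then have "c *s x = (\<Sum>b\<in>B. (c * u b) *s b)"
        by (simp add: vec.scale_sum_right vector_smult_assoc)
      then have "g (c *s x) = (\<Sum>b\<in>B. s b (c * u b) *s g b)"
        using g_coord[of "\<lambda>b. c * u b"] by simp
      also have "\<dots> = (\<Sum>b\<in>B. c' *s (s b (u b) *s g b))"
        using \<open>\<And>t b. b \<in> B \<Longrightarrow> s b (c * t) = c' * s b t\<close>
        by (intro sum.cong) (auto simp: vector_smult_assoc)
      also have "\<dots> = c' *s g x"
        using g_coord[of u] u by (simp add: vec.scale_sum_right)
      finally show ?thesis .
    qed
    then show ?thesis unfolding S_def by blast
  qed
  have S_diff: "c - d \<in> S" if cd: "c \<in> S" "d \<in> S" for c d
  proof -
    obtain c' d' where "\<forall>x\<in>H. g (c *s x) = c' *s g x" "\<forall>x\<in>H. g (d *s x) = d' *s g x"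
      using cd unfolding S_def by blast
    then have "\<forall>x\<in>H. g ((c - d) *s x) = (c' - d') *s g x"
      by (simp add: vec.scale_left_diff_distrib g_diff H_scale)
    then show ?thesis unfolding S_def by blast
  qed
  have S_1: "1 \<in> S"
    unfolding S_def by (auto intro: exI[of _ 1])
  then have S_00: "0 \<in> S"
    using S_diff[of 1 1] by simp
  have S_add: "c + d \<in> S" if "c \<in> S" "d \<in> S" for c d
    using S_diff[OF that(1) S_diff[OF S_00 that(2)]] by simp
  have "S = UNIV"
    using large
  proof
    assume "prime CARD('a)"
    then show ?thesis
      using additive_closed_prime_card_eq_UNIV[of S] S_00 S_1 S_add by blast
  next
    assume big: "vec.dim H + 2 \<le> CARD('a)"
    \<comment> \<open>The points of the arc outside the frame; there are q - n - 2 of them.\<close>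
    define F where "F = D - B - {e0}"
    have card_F: "card F = CARD('a) - vec.dim H - 1"
      using e0 B card_D by (simp add: F_def card_Diff_subset)
    have "\<exists>c. f = (\<Sum>b\<in>B. c b *s b)" if "f \<in> F" for f
      using coord_exists[OF B] D_H that by (auto simp: F_def)
    then obtain c where c: "\<And>f. f \<in> F \<Longrightarrow> f = (\<Sum>b\<in>B. c f b *s b)"
      by metis
    have F: "f \<in> D - B" "f \<in> D" "f \<noteq> e0" if "f \<in> F" for f
      using that by (auto simp: F_def)
    have c_0: "c f b \<noteq> 0" if "f \<in> F" "b \<in> B" for f b
      using coord_nonzero[OF B F(1) c] that by blast
    \<comment> \<open>The coordinates of \<open>f\<close> after the basis is rescaled so that
      \<open>e0\<close> becomes the all-one vector.\<close>
    define y where "y = (\<lambda>f b. c f b / a b)"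
    have y_0: "y f b \<noteq> 0" if "f \<in> F" "b \<in> B" for f b
      using c_0 a_0 that by (simp add: y_def)
    have \<tau>_y: "\<tau> (t * y f b) = s f t * \<tau> (y f b)" if "f \<in> F" "b \<in> B" for f b t
    proof -
      have "\<tau> (t * y f b) * s b (a b) = s f t * (\<tau> (y f b) * s b (a b))"
        using s_rel[OF F(2)[OF that(1)] c[OF that(1)] that(2), of t]
          s_\<tau>[OF that(2), of "t * c f b"] s_\<tau>[OF that(2), of "c f b"]
        by (simp add: y_def)
      then show ?thesis
        using s_0[of b "a b"] a_0 BD that by simp
    qed
    \<comment> \<open>By \<open>\<tau>_y\<close>, both \<open>\<tau> (t * y f b)\<close> and
      \<open>\<tau> (t * y f b')\<close> are fixed multiples of \<open>s f t\<close>. Hence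
      multiplying the argument of \<open>\<tau>\<close> by the ratio multiplies its value by a
      constant.\<close>
    have y_S: "y f b / y f b' \<in> S" if "f \<in> F" "b \<in> B" "b' \<in> B" for f b b'
    proof (rule S_I)
      fix t
      have "\<tau> (y f b / y f b' * t) = s f (t / y f b') * \<tau> (y f b)"
        using \<tau>_y[OF that(1,2), of "t / y f b'"] by (simp add: mult.commute)
      moreover have "\<tau> t = s f (t / y f b') * \<tau> (y f b')"
        using \<tau>_y[OF that(1,3), of "t / y f b'"] y_0[OF that(1,3)] by simp
      ultimately show "\<tau> (y f b / y f b' * t) = \<tau> (y f b) / \<tau> (y f b') * \<tau> t"
        using \<tau>_0[OF y_0[OF that(1,3)]] by simp
    qed
    \<comment> \<open>The minor of \<open>f\<close> and the unit point \<open>e0\<close> at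
      \<open>b\<close> and \<open>b'\<close> is nonzero.\<close>
    have y_inj: "b = b'" if "f \<in> F" "b \<in> B" "b' \<in> B" "y f b = y f b'" for f b b'
    proof (rule ccontr)
      assume "b \<noteq> b'"
      moreover have "1 * c f b + - y f b * a b = 0"
        using a_0[OF that(2)] by (simp add: y_def)
      moreover have "1 * c f b' + - y f b * a b' = 0"
        unfolding that(4) using a_0[OF that(3)] by (simp add: y_def)
      ultimately have "(1::'a) = 0"
        using coord_pair[OF B F(1)[OF that(1)] e0 F(3)[OF that(1)] c[OF that(1)] a that(2,3)]
        by blast
      then show False by simp
    qed
    \<comment> \<open>The same argument with the minor of two points \<open>f\<close> and
      \<open>f'\<close> outside the frame.\<close>
    have ratio_inj: "f = f'" if "f \<in> F" "f' \<in> F" "b \<in> B" "b' \<in> B" "b \<noteq> b'"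
      "y f b / y f b' = y f' b / y f' b'" for f f' b b'
    proof (rule ccontr)
      assume "f \<noteq> f'"
      have "c f' b' * c f b + - c f b' * c f' b = 0"
        using that(6) c_0 a_0 that(1-4) by (simp add: y_def field_simps)
      then have "c f' b' = 0"
        using coord_pair[OF B F(1)[OF that(1)] F(1)[OF that(2)] \<open>f \<noteq> f'\<close> c[OF that(1)]
            c[OF that(2)] that(3-5), of "c f' b'" "- c f b'"] by simp
      then show False using c_0 that by blast
    qed
    have "card B \<noteq> 0"
      unfolding B(2) using dim_ge by linarith
    then have "B \<noteq> {}"
      using card.empty by blast
    then obtain b where b: "b \<in> B"
      by blast
    have "\<not> B \<subseteq> {b}"
      using card_mono[of "{b}" B] B(2) dim_ge by (auto simp del: subset_singleton_iff)
    then obtain b' where b': "b' \<in> B" "b \<noteq> b'"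
      by blast
    have "F \<noteq> {}"
      using card_F big by auto
    then obtain f where f: "f \<in> F"
      by blast
    have "inj_on (\<lambda>b. y f b / y f b') B"
      using y_inj[OF f] y_0[OF f b'(1)] by (intro inj_onI) simp
    \<comment> \<open>First count, with \<open>f\<close> and \<open>b'\<close> fixed: 0 and the n +
      1 distinct ratios, among them 1 for \<open>b = b'\<close>, lie in \<open>S\<close>.\<close>
    then have "card (insert 0 ((\<lambda>b. y f b / y f b') ` B)) = vec.dim H + 1"
      using y_0[OF f] b' B(2) by (subst card_insert_disjoint) (auto simp: card_image)
    moreover have "card (insert 0 ((\<lambda>b. y f b / y f b') ` B)) \<le> card S"
      using S_00 y_S f b' by (intro card_mono) auto
    ultimately have 1: "vec.dim H + 1 \<le> card S"
      by simp
    have inj: "inj_on (\<lambda>f. y f b / y f b') F"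
      using ratio_inj b b' by (intro inj_onI) blast
    have "y f b / y f b' \<noteq> 1" if "f \<in> F" for f
      using y_inj[OF that b b'(1)] b'(2) y_0[OF that b'(1)] by (metis right_inverse_eq)
    then have "1 \<notin> (\<lambda>f. y f b / y f b') ` F"
      by force
    moreover have "0 \<notin> (\<lambda>f. y f b / y f b') ` F"
      using y_0 b b' by auto
    \<comment> \<open>Second count, with \<open>b\<close> and \<open>b'\<close> fixed: the ratios
      over all \<open>f\<close> differ from 0 and 1, which gives q - n elements of \<open>S\<close>.
      The two bounds add up to q + 2, so \<open>S\<close> has more than q / 2 elements.\<close>
    ultimately have "card (insert 0 (insert 1 ((\<lambda>f. y f b / y f b') ` F))) = card F + 2"
      using inj by (simp add: card_image)
    moreover have "card (insert 0 (insert 1 ((\<lambda>f. y f b / y f b') ` F))) \<le> card S"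
      using S_00 S_1 y_S b b' by (intro card_mono) auto
    ultimately have "card F + 2 \<le> card S"
      by simp
    then show ?thesis
      using additive_subgroup_eq_UNIV[of S] S_diff 1 card_F big by simp
  qed
  then have "\<forall>c. \<exists>c'. \<forall>x\<in>H. g (c *s x) = c' *s g x"
    unfolding S_def by blast
  then obtain \<sigma> where \<sigma>: "\<And>c x. x \<in> H \<Longrightarrow> g (c *s x) = \<sigma> c *s g x"
    by metis
  \<comment> \<open>The factor \<open>\<sigma> c\<close> is determined by its effect on the nonzero
    vector \<open>g e0\<close>, so the laws of a field automorphism are checked at \<open>e0\<close>
    only.\<close>
  have cancel: "c = c'" if "c *s g e0 = c' *s g e0" for c c'
    using that gd[of e0] e0 by (simp add: vec.scale_cancel_right)
  have e0H: "e0 \<in> H"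
    using e0 D_H by blast
  have "\<sigma> (x + y) = \<sigma> x + \<sigma> y" for x y
    by (rule cancel) (simp add: \<sigma>[OF e0H, symmetric] vector_sadd_rdistrib g_add H_scale e0H)
  moreover have "\<sigma> (x * y) = \<sigma> x * \<sigma> y" for x y
  proof (rule cancel)
    have "\<sigma> (x * y) *s g e0 = g ((x * y) *s e0)"
      by (rule \<sigma>[OF e0H, symmetric])
    also have "\<dots> = g (x *s (y *s e0))"
      by (simp only: vector_smult_assoc)
    also have "\<dots> = \<sigma> x *s (\<sigma> y *s g e0)"
      by (simp only: \<sigma> H_scale e0H)
    also have "\<dots> = (\<sigma> x * \<sigma> y) *s g e0"
      by (simp only: vector_smult_assoc)
    finally show "\<sigma> (x * y) *s g e0 = (\<sigma> x * \<sigma> y) *s g e0" .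
  qed
  moreover have "bij \<sigma>"
  proof -
    have "inj \<sigma>"
    proof (rule injI)
      fix x y assume "\<sigma> x = \<sigma> y"
      then have "g (x *s e0 - y *s e0) = 0"
        by (simp add: g_diff H_scale e0H \<sigma>)
      then have "x *s e0 - y *s e0 = 0"
        using g_inj[of "x *s e0 - y *s e0"] H_diff H_scale e0H by blast
      then show "x = y"
        using scale_cancel e0 by simp
    qed
    then show ?thesis
      by (simp add: bij_def finite_UNIV_inj_surj)
  qed
  ultimately show ?thesis
    using \<sigma> unfolding field_aut_def by blast
qed

section \<open>Far lines and far points in terms of vectors\<close>

text \<open>The direction of a transversal through the point with parameter \<open>t\<close> is
  neither \<open>d\<close> nor \<open>d'\<close>, and distinct parameters need distinct directions.
  So q parameters would inject into q - 2 directions.\<close>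

lemma far_lines_parallel:
  assumes d: "d \<in> D" "d' \<in> D"
    and disj: "\<And>t t'. w + t *s d \<noteq> w' + t' *s d'"
    and trans: "\<And>t. \<exists>e\<in>D. \<exists>r t'. w + t *s d + r *s e = w' + t' *s d'"
  shows "d = d'"
proof (rule ccontr)
  assume "d \<noteq> d'"
  have "\<forall>t. \<exists>e r t'. e \<in> D \<and> w + t *s d + r *s e = w' + t' *s d'"
    using trans by blast
  then obtain e r t' where e: "\<And>t. e t \<in> D"
    and eq: "\<And>t. w + t *s d + r t *s e t = w' + t' t *s d'"
    by metis
  \<comment> \<open>A transversal in direction \<open>d\<close> or \<open>d'\<close> would run
    inside one of the two lines and make them meet.\<close>
  have "e t \<noteq> d" for t
    using eq[of t] disj[of "t + r t" "t' t"] by (auto simp: vector_sadd_rdistrib add.assoc)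
  moreover have "e t \<noteq> d'" for t
    using eq[of t] disj[of t "t' t - r t"]
    by (auto simp: vec.scale_left_diff_distrib algebra_simps)
  ultimately have range: "range e \<subseteq> D - {d, d'}"
    using e by blast
  have eq': "t *s d + r t *s e t - t' t *s d' = w' - w" for t
    using eq[of t] by (simp add: algebra_simps)
  \<comment> \<open>Subtracting the relations for two parameters with the same transversal direction
    leaves a relation among \<open>d\<close>, \<open>e t\<close> and \<open>d'\<close> in which
    \<open>d\<close> has coefficient \<open>t - u\<close>.\<close>
  have "inj e"
  proof (rule injI)
    fix t u assume "e t = e u"
    then have "(t - u) *s d + (r t - r u) *s e t + (t' u - t' t) *s d'
        = (t *s d + r t *s e t - t' t *s d') - (u *s d + r u *s e u - t' u *s d')"
      by (simp add: vec.scale_left_diff_distrib algebra_simps)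
    also have "\<dots> = 0"
      by (simp only: eq' diff_self)
    finally have "t - u = 0"
      by (rule coeff_zero3(1)[rotated 6]) (use d e range \<open>d \<noteq> d'\<close> in auto)
    then show "t = u" by simp
  qed
  then have "CARD('a) = card (range e)"
    by (simp add: card_image)
  also have "\<dots> \<le> card (D - {d, d'})"
    by (rule card_mono) (use range in auto)
  also have "\<dots> < card D"
    by (rule psubset_card_mono) (use d in auto)
  finally show False
    using card_D by simp
qed

text \<open>Here \<open>z\<close> is the difference of two affine points. The partner
  \<open>e d\<close> of a direction is never \<open>d\<close> itself, and both coefficients in the
  representation of \<open>z\<close> are nonzero. Two such representations give a relation among at
  most four directions.\<close>

lemma no_far_points:
  assumes large: "4 \<le> vec.dim H \<or> odd CARD('a)"
    and not_on: "\<And>d t. d \<in> D \<Longrightarrow> z \<noteq> t *s d"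
    and secant: "\<And>d. d \<in> D \<Longrightarrow> \<exists>e\<in>D. \<exists>t s. z = t *s d + s *s e"
  shows False
proof -
  have "\<forall>d. \<exists>e t s. d \<in> D \<longrightarrow> e \<in> D \<and> z = t *s d + s *s e"
    using secant by blast
  then obtain e t s where e: "\<And>d. d \<in> D \<Longrightarrow> e d \<in> D"
    and z: "\<And>d. d \<in> D \<Longrightarrow> z = t d *s d + s d *s e d"
    by metis
  have e_ne: "e d \<noteq> d" if "d \<in> D" for d
    using z[OF that] not_on[OF that, of "t d + s d"] by (auto simp: vector_sadd_rdistrib)
  have t_0: "t d \<noteq> 0" if "d \<in> D" for d
    using z[OF that] not_on[OF e[OF that], of "s d"] by auto
  have s_0: "s d \<noteq> 0" if "d \<in> D" for d
    using z[OF that] not_on[OF that, of "t d"] by auto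
  show False
    using large
  proof
    assume four: "4 \<le> vec.dim H"
    have "card D \<noteq> 0"
      using dim_less by linarith
    then obtain d where d: "d \<in> D"
      by fastforce
    have "\<not> D \<subseteq> {d, e d}"
    proof
      assume "D \<subseteq> {d, e d}"
      then have "card D \<le> card {d, e d}"
        by (rule card_mono[rotated]) simp
      then show False
        using dim_less dim_ge by (simp add: card_insert_if split: if_splits)
    qed
    then obtain f where f: "f \<in> D" "f \<noteq> d" "f \<noteq> e d"
      by blast
    have eq: "t f *s f + s f *s e f = t d *s d + s d *s e d"
      using z[OF d] z[OF f(1)] by simp
    show False
    \<comment> \<open>The relation involves three or four directions according as the partner of
      \<open>f\<close> is among \<open>d\<close>, \<open>e d\<close> or not; either way the
      coefficient of \<open>f\<close> must vanish.\<close>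
    proof (cases "e f = d \<or> e f = e d")
      case True
      then have "t f *s f + ((if e f = d then s f else 0) - t d) *s d
          + ((if e f = d then 0 else s f) - s d) *s e d = 0"
        using eq e_ne[OF d] by (auto simp: vec.scale_left_diff_distrib algebra_simps)
      then have "t f = 0"
        by (rule coeff_zero3(1)[rotated 6]) (use d f e e_ne[OF d] in auto)
      then show ?thesis using t_0 f by blast
    next
      case False
      have "t f *s f + s f *s e f + (- t d) *s d + (- s d) *s e d = 0"
        using eq by (simp add: algebra_simps)
      then have "t f = 0"
        by (rule coeff_zero4(1)[OF four, rotated 5])
          (use d f e e_ne[OF d] e_ne[OF f(1)] False in auto)
      then show ?thesis using t_0 f by blast
    qed
  next
    assume odd: "odd CARD('a)"
    \<comment> \<open>Otherwise \<open>d\<close>, \<open>e d\<close> and \<open>e (e d)\<close>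
      would be three distinct directions in a relation with the nonzero coefficient
      \<open>t d\<close>.\<close>
    have "e (e d) = d" if d: "d \<in> D" for d
    proof (rule ccontr)
      assume ne: "e (e d) \<noteq> d"
      have "t d *s d + (s d - t (e d)) *s e d + (- s (e d)) *s e (e d) = 0"
        using z[OF d] z[OF e[OF d]] by (simp add: vec.scale_left_diff_distrib algebra_simps)
      then have "t d = 0"
        by (rule coeff_zero3(1)[rotated 6])
          (use d e ne e_ne[OF d] e_ne[OF e[OF d]] in \<open>auto dest: sym\<close>)
      then show False using t_0 d by blast
    qed
    then have "even (card D)"
      by (intro even_card_if_involution[of D e]) (auto simp: e e_ne)
    then show False
      using odd card_D by simp
  qed
qed

section \<open>From parallelism to additivity\<close>

text \<open>Increments are compared in three stages: opposite sides of a parallelogram have equal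
  increments; hence an increment along \<open>d\<close> does not depend on its starting point; hence
  neither does any increment, as \<open>D\<close> spans \<open>H\<close>.\<close>

lemma translation_invariant_if_parallel:
  assumes \<pi>: "\<And>d. d \<in> D \<Longrightarrow> \<pi> d \<in> D" "inj_on \<pi> D"
    and line: "\<And>x d t. x \<in> H \<Longrightarrow> d \<in> D \<Longrightarrow> \<exists>s. \<phi> (x + t *s d) = \<phi> x + s *s \<pi> d"
    and "x \<in> H" "y \<in> H"
  shows "\<phi> (x + y) - \<phi> x = \<phi> y - \<phi> 0"
proof -
  have parallelogram: "\<phi> (x + s *s e + t *s d) - \<phi> (x + s *s e) = \<phi> (x + t *s d) - \<phi> x"
    if x: "x \<in> H" and de: "d \<in> D" "e \<in> D" "d \<noteq> e" for x d e s t
  proof -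
    obtain a where a: "\<phi> (x + t *s d) = \<phi> x + a *s \<pi> d"
      using line x de by blast
    obtain b where b: "\<phi> (x + s *s e) = \<phi> x + b *s \<pi> e"
      using line x de by blast
    obtain a' where a': "\<phi> (x + s *s e + t *s d) = \<phi> (x + s *s e) + a' *s \<pi> d"
      using line[of "x + s *s e"] x de D_H H_add H_scale by blast
    obtain b' where b': "\<phi> (x + t *s d + s *s e) = \<phi> (x + t *s d) + b' *s \<pi> e"
      using line[of "x + t *s d"] x de D_H H_add H_scale by blast
    have "x + t *s d + s *s e = x + s *s e + t *s d"
      by (simp add: algebra_simps)
    \<comment> \<open>The fourth vertex is reached along both pairs of sides; independence of
      \<open>\<pi> d\<close> and \<open>\<pi> e\<close> separates the coefficients.\<close>
    then have "\<phi> x + b *s \<pi> e + a' *s \<pi> d = \<phi> x + a *s \<pi> d + b' *s \<pi> e"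
      using a b a' b' by metis
    then have "(a' - a) *s \<pi> d + (b - b') *s \<pi> e = 0"
      by (simp add: vec.scale_left_diff_distrib algebra_simps)
    then have "a' - a = 0"
      using coeff_zero2(1)[of "\<pi> d" "\<pi> e"] \<pi> de by (metis inj_on_eq_iff)
    then show ?thesis
      using a b a' by simp
  qed
  have dir: "\<phi> (x + y + t *s d) - \<phi> (x + y) = \<phi> (x + t *s d) - \<phi> x"
    if "x \<in> H" "y \<in> H" and d: "d \<in> D" for x y d t
  proof -
    \<comment> \<open>Parallelograms need two different directions. Without \<open>d\<close> the
      others still span \<open>H\<close>, so the starting point can be moved anywhere by steps not
      along \<open>d\<close>.\<close>
    have "vec.dim H \<le> card (D - {d})"
      using d dim_less by simp
    then have "y \<in> vec.span (D - {d})"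
      using span_eq[of "D - {d}"] \<open>y \<in> H\<close> by auto
    then have "\<forall>x\<in>H. \<phi> (x + y + t *s d) - \<phi> (x + y) = \<phi> (x + t *s d) - \<phi> x"
    proof (induction y rule: vec.span_induct_alt)
      case base
      then show ?case by simp
    next
      case (step c e y)
      show ?case
      proof
        fix x assume x: "x \<in> H"
        have e: "e \<in> D" "d \<noteq> e"
          using step(1) by auto
        have "x + c *s e \<in> H"
          using x e D_H H_add H_scale by blast
        then have "\<phi> (x + c *s e + y + t *s d) - \<phi> (x + c *s e + y)
            = \<phi> (x + c *s e + t *s d) - \<phi> (x + c *s e)"
          using step(2) by blast
        also have "\<dots> = \<phi> (x + t *s d) - \<phi> x"
          by (rule parallelogram) (use x d e in auto)
        finally show "\<phi> (x + (c *s e + y) + t *s d) - \<phi> (x + (c *s e + y))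
            = \<phi> (x + t *s d) - \<phi> x"
          by (simp add: add.assoc)
      qed
    qed
    then show ?thesis using \<open>x \<in> H\<close> by blast
  qed
  have "y \<in> vec.span D"
    using span_eq[of D] dim_less \<open>y \<in> H\<close> by simp
  then have "\<forall>x\<in>H. \<phi> (x + y) - \<phi> x = \<phi> y - \<phi> 0"
  proof (induction y rule: vec.span_induct_alt)
    case base
    then show ?case by simp
  next
    case (step c d y)
    show ?case
    proof
      fix x assume x: "x \<in> H"
      have cd: "c *s d \<in> H"
        using step(1) D_H H_scale by blast
      have "\<phi> (x + c *s d + y) - \<phi> (x + c *s d) = \<phi> y - \<phi> 0"
        using step(2) x cd H_add by blast
      then have 1: "\<phi> (x + c *s d + y) = \<phi> y - \<phi> 0 + \<phi> (x + c *s d)"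
        by (simp only: diff_eq_eq)
      have "\<phi> (c *s d + y) - \<phi> (c *s d) = \<phi> y - \<phi> 0"
        using step(2) cd by blast
      then have 2: "\<phi> (c *s d + y) = \<phi> y - \<phi> 0 + \<phi> (c *s d)"
        by (simp only: diff_eq_eq)
      have "\<phi> (x + c *s d) - \<phi> x = \<phi> (c *s d) - \<phi> 0"
        using dir[OF H_zero x step(1), of c] by simp
      then have 3: "\<phi> (x + c *s d) = \<phi> (c *s d) - \<phi> 0 + \<phi> x"
        by (simp only: diff_eq_eq)
      show "\<phi> (x + (c *s d + y)) - \<phi> x = \<phi> (c *s d + y) - \<phi> 0"
        unfolding add.assoc[symmetric] 1 2 3 by (simp add: algebra_simps)
    qed
  qed
  then show ?thesis using \<open>x \<in> H\<close> by blast
qed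

text \<open>After subtracting \<open>\<phi> 0\<close> the map is additive, and it sends each
  \<open>d\<close> to a nonzero multiple of \<open>\<pi> d\<close>. Since \<open>\<pi>\<close>
  permutes the directions, images of bases taken from \<open>D\<close> stay independent.\<close>

lemma semilinear_if_parallel:
  assumes \<pi>: "\<And>d. d \<in> D \<Longrightarrow> \<pi> d \<in> D" "inj_on \<pi> D"
    and line: "\<And>x d t. x \<in> H \<Longrightarrow> d \<in> D \<Longrightarrow> \<exists>s. \<phi> (x + t *s d) = \<phi> x + s *s \<pi> d"
    and inj: "inj_on \<phi> H"
    and large: "prime CARD('a) \<or> vec.dim H + 2 \<le> CARD('a)"
  shows "\<exists>\<sigma>. field_aut \<sigma> \<and> (\<forall>c. \<forall>x\<in>H. \<phi> (c *s x) - \<phi> 0 = \<sigma> c *s (\<phi> x - \<phi> 0))"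
proof -
  let ?g = "\<lambda>x. \<phi> x - \<phi> 0"
  have "\<forall>d t. \<exists>s. d \<in> D \<longrightarrow> ?g (t *s d) = s *s \<pi> d"
    using line[OF H_zero] by (metis add_diff_cancel_left' add_0)
  then obtain s where s: "\<And>d t. d \<in> D \<Longrightarrow> ?g (t *s d) = s d t *s \<pi> d"
    by metis
  have g_inj: "x = 0" if "x \<in> H" "?g x = 0" for x
    using inj_onD[OF inj, of x 0] that H_zero by simp
  have s1: "?g d = s d 1 *s \<pi> d" if "d \<in> D" for d
    using s[OF that, of 1] by simp
  have s1_0: "s d 1 \<noteq> 0" if "d \<in> D" for d
    using s1[OF that] g_inj[of d] D_H[OF that] nonzero[OF that] by auto
  show ?thesis
  proof (rule semilinear_if_additive)
    show "?g (x + y) = ?g x + ?g y" if "x \<in> H" "y \<in> H" for x y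
      using translation_invariant_if_parallel[of \<pi> \<phi>, OF \<pi> line that]
      by (simp add: algebra_simps)
    show "x = 0" if "x \<in> H" "?g x = 0" for x
      using g_inj that .
    show "\<exists>r. ?g (t *s d) = r *s ?g d" if "d \<in> D" for d t
      using s[OF that, of t] s1[OF that] s1_0[OF that]
      by (intro exI[of _ "s d t / s d 1"]) (simp add: vector_smult_assoc)
    show "c d = 0"
      if T: "T \<subseteq> D" "card T = vec.dim H" and 0: "(\<Sum>d\<in>T. c d *s ?g d) = 0" and d: "d \<in> T"
      for T c d
    proof -
      \<comment> \<open>Transports the coefficients along \<open>\<pi>\<close>; the factor
        \<open>s d 1\<close> relates the image of \<open>d\<close> to
        \<open>\<pi> d\<close>.\<close>
      define u where "u = (\<lambda>e. c (inv_into D \<pi> e) * s (inv_into D \<pi> e) 1)"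
      have u: "u (\<pi> d) = c d * s d 1" if "d \<in> D" for d
        using that \<pi>(2) by (simp add: u_def)
      have inj_T: "inj_on \<pi> T"
        using \<pi>(2) T(1) inj_on_subset by blast
      have "(\<Sum>e\<in>\<pi> ` T. u e *s e) = (\<Sum>d\<in>T. u (\<pi> d) *s \<pi> d)"
        using inj_T by (simp add: sum.reindex)
      also have "\<dots> = (\<Sum>d\<in>T. c d *s ?g d)"
      proof (rule sum.cong)
        fix d assume "d \<in> T"
        then have "d \<in> D" using T(1) by blast
        then show "u (\<pi> d) *s \<pi> d = c d *s ?g d"
          using u s1 by (simp add: vector_smult_assoc)
      qed simp
      finally have "u (\<pi> d) = 0"
        using coeff_zero[of "\<pi> ` T" u "\<pi> d"] \<pi>(1) T inj_T d 0 by (auto simp: card_image)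
      then show ?thesis
        using u[of d] s1_0[of d] d T(1) by auto
    qed
    show "prime CARD('a) \<or> vec.dim H + 2 \<le> CARD('a)"
      by (rule large)
  qed
qed

end

section \<open>Points, hyperplanes and semilinear maps\<close>

lemma span_singleton_scale:
  fixes u :: "'a::field ^ 'd::finite"
  assumes "c \<noteq> 0"
  shows "vec.span {c *s u} = vec.span {u}"
proof
  show "vec.span {c *s u} \<subseteq> vec.span {u}"
    by (intro vec.span_minimal) (auto intro: vec.span_scale vec.span_base)
  have "u = (1 / c) *s (c *s u)"
    using assms by (simp add: vector_smult_assoc)
  also have "\<dots> \<in> vec.span {c *s u}"
    by (intro vec.span_scale vec.span_base) simp
  finally show "vec.span {u} \<subseteq> vec.span {c *s u}"
    by (intro vec.span_minimal) auto
qed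

lemma dim_span_singleton:
  fixes u :: "'a::field ^ 'd::finite"
  assumes "u \<noteq> 0"
  shows "vec.dim (vec.span {u}) = 1"
  using vec.dim_span_eq_card_independent[of "{u}"] assms by simp

lemma pg_point_singleton:
  assumes "u \<noteq> 0" "u \<in> U" "vec.subspace U"
  shows "vec.span {u} \<in> pg_points U"
  using assms vec.span_minimal[of "{u}" U] by (simp add: pg_points_def dim_span_singleton)

lemma pg_point_obtain:
  assumes "P \<in> pg_points U"
  obtains u where "u \<noteq> 0" "P = vec.span {u}" "u \<in> U"
proof -
  have P: "vec.subspace P" "vec.dim P = 1" "P \<subseteq> U"
    using assms by (auto simp: pg_points_def)
  obtain B where B: "B \<subseteq> P" "vec.independent B" "P \<subseteq> vec.span B" "card B = vec.dim P"
    using vec.basis_exists[of P] by blast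
  then obtain u where u: "B = {u}"
    using P(2) by (metis card_1_singletonE)
  then have "u \<noteq> 0"
    using B(2) by auto
  moreover have "P = vec.span {u}"
    using B(1,3) u vec.span_minimal[OF _ P(1)] by blast
  ultimately show ?thesis
    using that B(1) P(3) u by blast
qed

text \<open>This turns the arc condition on hyperplanes into linear independence. A maximal
  independent part of \<open>T\<close> does not generate \<open>U\<close>; it is extended to a basis
  of \<open>U\<close>, and one of the added vectors is dropped.\<close>

lemma hyperplane_if_dependent:
  fixes U T :: "('a::{field,finite} ^ 'd::finite) set"
  assumes U: "vec.subspace U" and T: "T \<subseteq> U" "card T = vec.dim U" "\<not> vec.independent T"
  obtains W where "W \<in> pg_hyperplanes U" "T \<subseteq> W"
proof -
  have not_span: "\<not> U \<subseteq> vec.span T"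
    using vec.card_eq_dim[OF T(1,2)] T(3) by simp
  obtain B0 where B0: "B0 \<subseteq> T" "vec.independent B0" "T \<subseteq> vec.span B0"
    using vec.maximal_independent_subset[of T] by blast
  have "B0 \<subseteq> U"
    using B0(1) T(1) by blast
  then obtain B where B: "B0 \<subseteq> B" "B \<subseteq> U" "vec.independent B" "U \<subseteq> vec.span B"
    using vec.maximal_independent_subset_extend[OF _ B0(2), of U] by blast
  have card_B: "card B = vec.dim U"
    using vec.basis_card_eq_dim[OF B(2,4,3)] by simp
  have "B0 \<noteq> B"
    using B(4) not_span vec.span_mono[OF B0(1)] by blast
  then obtain b where b: "b \<in> B" "b \<notin> B0"
    using B(1) by blast
  let ?W = "vec.span (B - {b})"
  have "vec.dim ?W = card (B - {b})"
    using vec.independent_mono[OF B(3)] by (intro vec.dim_span_eq_card_independent) auto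
  then have "vec.dim ?W + 1 = vec.dim U"
    using card_B card_Suc_Diff1[OF _ b(1)] by simp
  moreover have "?W \<subseteq> U"
    using B(2) by (intro vec.span_minimal[OF _ U]) auto
  ultimately have "?W \<in> pg_hyperplanes U"
    by (simp add: pg_hyperplanes_def)
  moreover have "T \<subseteq> ?W"
    using B0(3) B(1) b vec.span_mono[of B0 "B - {b}"] by blast
  ultimately show ?thesis
    using that by blast
qed

lemma semilinear_image_span:
  assumes "semilinear_bij \<sigma> f"
  shows "f ` vec.span S = vec.span (f ` S)"
proof
  have f: "f (x + y) = f x + f y" "f (c *s x) = \<sigma> c *s f x" for c x y
    using assms by (auto simp: semilinear_bij_def)
  have f_0: "f 0 = 0"
    using f(1)[of 0 0] by simp
  have \<sigma>: "bij \<sigma>"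
    using assms by (auto simp: semilinear_bij_def field_aut_def)
  show "f ` vec.span S \<subseteq> vec.span (f ` S)"
  proof
    fix y assume "y \<in> f ` vec.span S"
    then obtain x where x: "x \<in> vec.span S" "y = f x"
      by blast
    have "f x \<in> vec.span (f ` S)"
      using x(1)
    proof (induction x rule: vec.span_induct_alt)
      case base
      show ?case by (simp add: f_0 vec.span_zero)
    next
      case (step c x y)
      then show ?case
        unfolding f by (intro vec.span_add vec.span_scale) (auto intro: vec.span_base)
    qed
    then show "y \<in> vec.span (f ` S)"
      by (simp add: x(2))
  qed
  show "vec.span (f ` S) \<subseteq> f ` vec.span S"
  proof
    fix y assume "y \<in> vec.span (f ` S)"
    then show "y \<in> f ` vec.span S"
    proof (induction y rule: vec.span_induct_alt)
      case base
      show ?case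
        using f_0 vec.span_zero[of S] by force
    next
      case (step c x y)
      obtain u v where uv: "x = f u" "u \<in> S" "y = f v" "v \<in> vec.span S"
        using step by blast
      \<comment> \<open>Scalars on the image side are pulled back along the bijection
        \<open>\<sigma>\<close>.\<close>
      have "c *s x + y = f (inv_into UNIV \<sigma> c *s u + v)"
        using \<sigma> by (simp add: f uv surj_f_inv_f bij_is_surj)
      moreover have "inv_into UNIV \<sigma> c *s u + v \<in> vec.span S"
        using uv by (intro vec.span_add vec.span_scale) (auto intro: vec.span_base)
      ultimately show ?case by blast
    qed
  qed
qed

lemma semilinear_bij_compose:
  assumes "semilinear_bij \<sigma> f" "semilinear_bij \<tau> g"
  shows "semilinear_bij (\<sigma> \<circ> \<tau>) (f \<circ> g)"
  using assms unfolding semilinear_bij_def field_aut_def by (auto intro: bij_comp)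

text \<open>The explicit homomorphism below runs from the stabiliser to the automorphism group,
  opposite to the stated isomorphism. Closure of \<open>G\<close> is all that inverting it
  takes.\<close>

lemma is_iso_if_inverse_iso:
  assumes h: "h \<in> hom G H" and bij: "bij_betw h (carrier G) (carrier H)"
    and closed: "\<And>x y. x \<in> carrier G \<Longrightarrow> y \<in> carrier G \<Longrightarrow> x \<otimes>\<^bsub>G\<^esub> y \<in> carrier G"
  shows "H \<cong> G"
proof -
  let ?i = "inv_into (carrier G) h"
  have i: "?i x \<in> carrier G" "h (?i x) = x" if "x \<in> carrier H" for x
    using that bij by (auto simp: bij_betw_def inv_into_into f_inv_into_f)
  have "?i \<in> hom H G"
  proof (rule homI)
    fix x y assume xy: "x \<in> carrier H" "y \<in> carrier H"
    have "h (?i x \<otimes>\<^bsub>G\<^esub> ?i y) = x \<otimes>\<^bsub>H\<^esub> y"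
      using hom_mult[OF h] i xy by metis
    then show "?i (x \<otimes>\<^bsub>H\<^esub> y) = ?i x \<otimes>\<^bsub>G\<^esub> ?i y"
      using closed i xy bij by (metis bij_betw_def inv_into_f_f)
  qed (use i in auto)
  then show ?thesis
    using bij_betw_inv_into[OF bij] unfolding is_iso_def iso_def by blast
qed

definition far :: "'v sgraph \<Rightarrow> 'v \<Rightarrow> 'v \<Rightarrow> bool" where
  "far G u v \<longleftrightarrow>
     (\<nexists>z. {u, z} \<in> snd G \<and> {z, v} \<in> snd G) \<and>
     (\<forall>x. {u, x} \<in> snd G \<longrightarrow>
        (\<exists>k y. {x, k} \<in> snd G \<and> {k, y} \<in> snd G \<and> {y, v} \<in> snd G))"

text \<open>The relation is built from adjacency alone. Every neighbour is a vertex by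
  \<open>edges\<close>, so it has a preimage under \<open>\<alpha>\<close>, to which the hypothesis
  applies.\<close>

lemma far_graph_Aut:
  assumes \<alpha>: "\<alpha> \<in> carrier (graph_Aut G)" and edges: "\<Union> (snd G) \<subseteq> fst G"
    and uv: "u \<in> fst G" "v \<in> fst G" and far: "far G u v"
  shows "far G (\<alpha> u) (\<alpha> v)"
proof -
  have bij: "bij_betw \<alpha> (fst G) (fst G)"
    and adj: "\<And>u v. u \<in> fst G \<Longrightarrow> v \<in> fst G \<Longrightarrow> {\<alpha> u, \<alpha> v} \<in> snd G \<longleftrightarrow> {u, v} \<in> snd G"
    using \<alpha> by (auto simp: graph_Aut_def Bij_def)
  have V: "x \<in> fst G" "y \<in> fst G" if "{x, y} \<in> snd G" for x y
    using edges that by auto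
  have pre: "\<exists>x'\<in>fst G. x = \<alpha> x'" if "x \<in> fst G" for x
    using bij that by (auto simp: bij_betw_def)
  show ?thesis
    unfolding far_def
  proof (intro conjI allI impI notI)
    assume "\<exists>z. {\<alpha> u, z} \<in> snd G \<and> {z, \<alpha> v} \<in> snd G"
    then obtain z where z: "z \<in> fst G" "{\<alpha> u, \<alpha> z} \<in> snd G" "{\<alpha> z, \<alpha> v} \<in> snd G"
      using pre V by metis
    then show False
      using far adj uv unfolding far_def by blast
  next
    fix x assume "{\<alpha> u, x} \<in> snd G"
    then obtain x' where x': "x' \<in> fst G" "x = \<alpha> x'" "{u, x'} \<in> snd G"
      using pre V adj uv by metis
    then obtain k y where ky: "{x', k} \<in> snd G" "{k, y} \<in> snd G" "{y, v} \<in> snd G"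
      using far unfolding far_def by blast
    then have "{\<alpha> x', \<alpha> k} \<in> snd G" "{\<alpha> k, \<alpha> y} \<in> snd G" "{\<alpha> y, \<alpha> v} \<in> snd G"
      using adj V by blast+
    then show "\<exists>k y. {x, k} \<in> snd G \<and> {k, y} \<in> snd G \<and> {y, \<alpha> v} \<in> snd G"
      using x'(2) by blast
  qed
qed

section \<open>The graph in affine coordinates\<close>

text \<open>The vector \<open>v0\<close> serves as an origin for the affine points. In
  \<open>large\<close> the second alternative is q >= n + 3; in \<open>four_or_odd\<close> the first
  is n >= 3.\<close>

locale linear_rep = affine_arc H D
  for H D :: "('a::{field,finite} ^ 'd::finite) set" +
  fixes K :: "('a ^ 'd) set set" and v0 :: "'a ^ 'd"
  assumes codim: "vec.dim H + 1 = CARD('d)"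
    and v0: "v0 \<notin> H"
    and K_eq: "K = (\<lambda>d. vec.span {d}) ` D"
    and large: "prime CARD('a) \<or> vec.dim H + 2 \<le> CARD('a)"
    and four_or_odd: "4 \<le> vec.dim H \<or> odd CARD('a)"
begin

section \<open>The coordinate along \<open>v0\<close>\<close>

lemma span_H: "vec.span H = H"
  using vec.span_eq_iff subspace_H by blast

lemma scale_v0_H: "c *s v0 \<in> H \<longleftrightarrow> c = 0"
proof
  assume "c *s v0 \<in> H"
  then have "(1 / c) *s (c *s v0) \<in> H"
    by (rule H_scale)
  then show "c = 0"
    using v0 by (cases "c = 0") (simp_all add: vector_smult_assoc)
qed (simp add: H_zero)

lemma coord_v0_exists: "\<exists>c. u - c *s v0 \<in> H"
proof -
  have "vec.dim (insert v0 H) = CARD('d)"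
    using v0 codim by (simp add: vec.dim_insert span_H)
  then have "vec.span (insert v0 H) = UNIV"
    by (intro vec.subspace_dim_equal) (simp_all add: vec_dim_card del: vec.dim_UNIV)
  then have "u \<in> vec.span (insert v0 H)"
    by simp
  then show ?thesis
    by (simp add: vec.span_breakdown_eq span_H)
qed

text \<open>This is the linear functional with kernel \<open>H\<close> and value 1 at
  \<open>v0\<close>.\<close>

definition \<kappa> :: "'a ^ 'd \<Rightarrow> 'a" where
  "\<kappa> u = (SOME c. u - c *s v0 \<in> H)"

lemma \<kappa>_H: "u - \<kappa> u *s v0 \<in> H"
  unfolding \<kappa>_def using someI_ex[OF coord_v0_exists] .

lemma \<kappa>_eqI:
  assumes "u - c *s v0 \<in> H"
  shows "\<kappa> u = c"
proof -
  have "(u - c *s v0) - (u - \<kappa> u *s v0) \<in> H"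
    using assms \<kappa>_H H_diff by blast
  then have "(\<kappa> u - c) *s v0 \<in> H"
    by (simp add: vec.scale_left_diff_distrib)
  then show ?thesis
    by (simp add: scale_v0_H)
qed

lemma \<kappa>_add: "\<kappa> (u + v) = \<kappa> u + \<kappa> v"
proof (rule \<kappa>_eqI)
  have "u + v - (\<kappa> u + \<kappa> v) *s v0 = (u - \<kappa> u *s v0) + (v - \<kappa> v *s v0)"
    by (simp add: vector_sadd_rdistrib)
  then show "u + v - (\<kappa> u + \<kappa> v) *s v0 \<in> H"
    using \<kappa>_H H_add by metis
qed

lemma \<kappa>_scale: "\<kappa> (c *s u) = c * \<kappa> u"
proof (rule \<kappa>_eqI)
  have "c *s u - (c * \<kappa> u) *s v0 = c *s (u - \<kappa> u *s v0)"
    by (simp add: vec.scale_right_diff_distrib vector_smult_assoc)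
  then show "c *s u - (c * \<kappa> u) *s v0 \<in> H"
    using \<kappa>_H H_scale by metis
qed

lemma \<kappa>_eq_0: "\<kappa> u = 0 \<longleftrightarrow> u \<in> H"
  using \<kappa>_H[of u] \<kappa>_eqI[of u 0] by auto

lemma \<kappa>_v0: "\<kappa> v0 = 1"
  by (rule \<kappa>_eqI) (simp add: H_zero)

lemma \<kappa>_pt: "w \<in> H \<Longrightarrow> \<kappa> (v0 + w) = 1"
  by (simp add: \<kappa>_add \<kappa>_v0 \<kappa>_eq_0)

section \<open>Affine points and lines as translates\<close>

definition pt :: "'a ^ 'd \<Rightarrow> ('a ^ 'd) set" where
  "pt w = vec.span {v0 + w}"

definition lin :: "'a ^ 'd \<Rightarrow> 'a ^ 'd \<Rightarrow> ('a ^ 'd) set" where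
  "lin w d = vec.span {v0 + w, d}"

lemma mem_pt: "u \<in> pt w \<longleftrightarrow> (\<exists>c. u = c *s (v0 + w))"
  by (auto simp: pt_def vec.span_singleton)

lemma mem_lin: "u \<in> lin w d \<longleftrightarrow> (\<exists>c t. u = c *s (v0 + w) + t *s d)"
  unfolding lin_def vec.span_breakdown_eq vec.span_singleton
  by (simp add: image_iff diff_eq_eq add.commute)

lemma affine_point_obtain:
  assumes "u \<notin> H"
  obtains c w where "c \<noteq> 0" "w \<in> H" "u = c *s (v0 + w)"
proof
  have 0: "\<kappa> u \<noteq> 0"
    using assms \<kappa>_eq_0 by simp
  then show "\<kappa> u \<noteq> 0" .
  show "(1 / \<kappa> u) *s (u - \<kappa> u *s v0) \<in> H"
    by (intro H_scale \<kappa>_H)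
  show "u = \<kappa> u *s (v0 + (1 / \<kappa> u) *s (u - \<kappa> u *s v0))"
    using 0 by (simp add: vec.scale_right_diff_distrib vec.scale_right_distrib vector_smult_assoc)
qed

lemma pt_notin_H: "w \<in> H \<Longrightarrow> v0 + w \<notin> H"
  using \<kappa>_pt[of w] \<kappa>_eq_0[of "v0 + w"] by auto

lemma affine_point_span:
  assumes "u \<notin> H"
  shows "vec.span {u} \<in> affine_points H"
proof -
  have "u \<noteq> 0"
    using assms H_zero by blast
  then show ?thesis
    using assms vec.span_base[of u "{u}"] pg_point_singleton[of u UNIV]
    by (auto simp: affine_points_def pg_points_def)
qed

lemma affine_points_eq: "affine_points H = pt ` H"
proof
  show "affine_points H \<subseteq> pt ` H"
  proof
    fix P assume P: "P \<in> affine_points H"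
    then obtain u where u: "u \<noteq> 0" "P = vec.span {u}"
      by (auto simp: affine_points_def elim: pg_point_obtain)
    have "u \<notin> H"
      using P u pg_point_singleton[OF u(1) _ subspace_H] by (auto simp: affine_points_def)
    then obtain c w where "c \<noteq> 0" "w \<in> H" "u = c *s (v0 + w)"
      by (rule affine_point_obtain)
    then show "P \<in> pt ` H"
      using u(2) span_singleton_scale by (auto simp: pt_def)
  qed
  show "pt ` H \<subseteq> affine_points H"
    using affine_point_span pt_notin_H by (auto simp: pt_def)
qed

lemma pt_inj:
  assumes "x \<in> H" "y \<in> H" "pt x = pt y"
  shows "x = y"
proof -
  have "v0 + x \<in> pt y"
    using assms(3) mem_pt[of "v0 + x" x] by (metis vec.scale_one)
  then obtain c where c: "v0 + x = c *s (v0 + y)"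
    using mem_pt by blast
  have "c = 1"
    using arg_cong[OF c, of \<kappa>] assms(1,2) by (simp add: \<kappa>_scale \<kappa>_pt)
  then show ?thesis
    using c by simp
qed

lemma pt_subset_lin:
  assumes "x \<in> H" "w \<in> H" "d \<in> D"
  shows "pt x \<subseteq> lin w d \<longleftrightarrow> (\<exists>t. x = w + t *s d)"
proof
  assume "pt x \<subseteq> lin w d"
  then have "v0 + x \<in> lin w d"
    by (metis mem_pt subsetD vec.scale_one)
  then obtain c t where c: "v0 + x = c *s (v0 + w) + t *s d"
    using mem_lin by blast
  \<comment> \<open>Both sides are evaluated under \<open>\<kappa>\<close>, which is 1 on
    \<open>v0 + x\<close> and \<open>v0 + w\<close> and 0 on \<open>d\<close>.\<close>
  have "c = 1"
    using arg_cong[OF c, of \<kappa>] assms D_H[OF assms(3)] \<kappa>_eq_0[of d]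
    by (simp add: \<kappa>_add[of "c *s (v0 + w)"] \<kappa>_scale \<kappa>_pt)
  then show "\<exists>t. x = w + t *s d"
    using c by (auto simp: add.assoc)
next
  assume "\<exists>t. x = w + t *s d"
  then obtain t where "x = w + t *s d" by blast
  then have "v0 + x \<in> lin w d"
    unfolding mem_lin by (intro exI[of _ 1] exI[of _ t]) (simp add: add.assoc)
  then show "pt x \<subseteq> lin w d"
    unfolding pt_def lin_def by (intro vec.span_minimal) auto
qed

text \<open>The point at infinity recovers the direction from the line, so that it makes sense to
  ask how an automorphism acts on directions.\<close>

lemma lin_Int_H:
  assumes "w \<in> H" "d \<in> D"
  shows "lin w d \<inter> H = vec.span {d}"
proof
  show "lin w d \<inter> H \<subseteq> vec.span {d}"
  proof
    fix u assume "u \<in> lin w d \<inter> H"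
    then obtain c t where u: "u = c *s (v0 + w) + t *s d" "u \<in> H"
      using mem_lin by blast
    have "c = 0"
      using u assms D_H[OF assms(2)] \<kappa>_eq_0[of d] \<kappa>_eq_0[of u]
      by (simp add: \<kappa>_add[of "c *s (v0 + w)"] \<kappa>_scale \<kappa>_pt)
    then show "u \<in> vec.span {d}"
      using u by (simp add: vec.span_scale vec.span_base)
  qed
  show "vec.span {d} \<subseteq> lin w d \<inter> H"
    unfolding lin_def
    using vec.span_mono[of "{d}" "{v0 + w, d}"] vec.span_minimal[OF _ subspace_H, of "{d}"]
      D_H[OF assms(2)] by auto
qed

lemma span_D_inj:
  assumes "d \<in> D" "e \<in> D" "vec.span {d} = vec.span {e}"
  shows "d = e"
proof (rule ccontr)
  assume "d \<noteq> e"
  have "d \<in> vec.span {e}"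
    using assms(3) vec.span_base[of d "{d}"] by simp
  then obtain k where "d = k *s e"
    by (auto simp: vec.span_singleton)
  then have "1 *s d + (- k) *s e = 0"
    by simp
  then have "(1::'a) = 0"
    using coeff_zero2(1)[OF assms(1,2) \<open>d \<noteq> e\<close>] by blast
  then show False by simp
qed

lemma lin_eq_dir:
  assumes "w \<in> H" "w' \<in> H" "d \<in> D" "d' \<in> D" "lin w d = lin w' d'"
  shows "d = d'"
  using assms lin_Int_H span_D_inj by metis

lemma dim_lin:
  assumes "w \<in> H" "d \<in> D"
  shows "vec.dim (lin w d) = 2"
proof -
  have "v0 + w \<notin> vec.span {d}"
    using pt_notin_H[OF assms(1)] vec.span_minimal[OF _ subspace_H, of "{d}"] D_H[OF assms(2)]
    by blast
  moreover have "vec.dim {d} = 1"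
    using dim_span_singleton[of d] nonzero[OF assms(2)] by simp
  ultimately show ?thesis
    by (simp add: lin_def vec.dim_insert)
qed

lemma lin_shift:
  assumes "w \<in> H" "d \<in> D"
  shows "lin (w + t *s d) d = lin w d"
proof -
  have "v0 + (w + t *s d) \<in> lin w d"
    unfolding mem_lin by (intro exI[of _ 1] exI[of _ t]) (simp add: add.assoc)
  then have "lin (w + t *s d) d \<subseteq> lin w d"
    unfolding lin_def by (intro vec.span_minimal) (auto intro: vec.span_base)
  moreover have "w + t *s d \<in> H"
    using assms D_H H_add H_scale by blast
  ultimately show ?thesis
    using assms by (intro vec.subspace_dim_equal) (simp_all add: dim_lin, auto simp: lin_def)
qed

lemma rep_line_span:
  assumes "u \<notin> H" "d \<in> D"
  shows "\<exists>w\<in>H. vec.span {u, d} = lin w d"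
proof -
  obtain c w where u: "c \<noteq> 0" "w \<in> H" "u = c *s (v0 + w)"
    using affine_point_obtain[OF assms(1)] .
  have "v0 + w = (1 / c) *s u"
    using u by (simp add: vector_smult_assoc)
  then have "vec.span {v0 + w, d} \<subseteq> vec.span {u, d}"
    by (intro vec.span_minimal) (auto intro: vec.span_scale vec.span_base)
  moreover have "vec.span {u, d} \<subseteq> vec.span {v0 + w, d}"
    unfolding u(3) by (intro vec.span_minimal) (auto intro: vec.span_scale vec.span_base)
  ultimately have "vec.span {u, d} = lin w d"
    by (simp add: lin_def)
  then show ?thesis
    using u(2) by blast
qed

text \<open>A line of the graph is generated by its point at infinity and any vector outside
  \<open>H\<close>; a comparison of dimensions gives equality.\<close>

lemma rep_lines_eq: "rep_lines H K = {lin w d | w d. w \<in> H \<and> d \<in> D}"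
proof (intro equalityI subsetI)
  fix L assume "L \<in> rep_lines H K"
  then obtain d where L: "vec.subspace L" "vec.dim L = 2" "\<not> L \<subseteq> H" "d \<in> D" "vec.span {d} \<subseteq> L"
    by (auto simp: rep_lines_def pg_lines_def K_eq)
  then obtain u where u: "u \<in> L" "u \<notin> H"
    by blast
  obtain w where w: "w \<in> H" "vec.span {u, d} = lin w d"
    using rep_line_span[OF u(2) L(4)] by blast
  have "lin w d \<subseteq> L"
    unfolding w(2)[symmetric] using u(1) L(5) vec.span_base[of d "{d}"]
    by (intro vec.span_minimal L(1)) auto
  then have "lin w d = L"
    using L(1,2) dim_lin[OF w(1) L(4)] by (intro vec.subspace_dim_equal) (auto simp: lin_def)
  then show "L \<in> {lin w d | w d. w \<in> H \<and> d \<in> D}"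
    using w(1) L(4) by blast
next
  fix L assume "L \<in> {lin w d | w d. w \<in> H \<and> d \<in> D}"
  then obtain w d where L: "L = lin w d" "w \<in> H" "d \<in> D"
    by blast
  have "\<not> lin w d \<subseteq> H"
    using pt_notin_H[OF L(2)] vec.span_base[of "v0 + w" "{v0 + w, d}"] by (auto simp: lin_def)
  then show "L \<in> rep_lines H K"
    using L dim_lin[OF L(2,3)] lin_Int_H[OF L(2,3)]
    by (auto simp: rep_lines_def pg_lines_def K_eq lin_def)
qed

lemma pt_ne_lin:
  assumes "x \<in> H" "w \<in> H" "d \<in> D"
  shows "pt x \<noteq> lin w d"
proof -
  have "v0 + x \<noteq> 0"
    using pt_notin_H[OF assms(1)] H_zero by metis
  then have "vec.dim (pt x) = 1"
    using dim_span_singleton by (simp only: pt_def)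
  then show ?thesis
    using dim_lin[OF assms(2,3)] by auto
qed

section \<open>Adjacency and the far relation in coordinates\<close>

abbreviation "\<Gamma> \<equiv> Gamma_graph H K"

lemma vertices: "fst \<Gamma> = pt ` H \<union> {lin w d | w d. w \<in> H \<and> d \<in> D}"
  by (simp add: Gamma_graph_def affine_points_eq rep_lines_eq)

lemma edges_subset: "\<Union> (snd \<Gamma>) \<subseteq> fst \<Gamma>"
  by (auto simp: Gamma_graph_def)

lemma edge_iff:
  "{u, v} \<in> snd \<Gamma> \<longleftrightarrow>
    (u \<in> affine_points H \<and> v \<in> rep_lines H K \<and> u \<subseteq> v) \<or>
    (v \<in> affine_points H \<and> u \<in> rep_lines H K \<and> v \<subseteq> u)"
  by (auto simp: Gamma_graph_def doubleton_eq_iff)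

lemma disjoint: "u \<in> affine_points H \<Longrightarrow> u \<notin> rep_lines H K"
  using pt_ne_lin by (auto simp: affine_points_eq rep_lines_eq)

lemma edge_pt:
  assumes "x \<in> H"
  shows "{pt x, z} \<in> snd \<Gamma> \<longleftrightarrow> (\<exists>d\<in>D. z = lin x d)"
proof
  assume "{pt x, z} \<in> snd \<Gamma>"
  then have "z \<in> rep_lines H K" "pt x \<subseteq> z"
    using assms pt_ne_lin by (auto simp: edge_iff affine_points_eq rep_lines_eq)
  then obtain w d where w: "w \<in> H" "d \<in> D" "z = lin w d" "pt x \<subseteq> lin w d"
    by (auto simp: rep_lines_eq)
  then obtain t where "x = w + t *s d"
    using pt_subset_lin assms by blast
  then have "z = lin x d"
    using w(3) lin_shift[OF w(1,2), of t] by simp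
  then show "\<exists>d\<in>D. z = lin x d"
    using w(2) by blast
next
  assume "\<exists>d\<in>D. z = lin x d"
  then obtain d where d: "d \<in> D" "z = lin x d"
    by blast
  then have "pt x \<subseteq> z"
    using pt_subset_lin[OF assms assms d(1)] by (auto intro: exI[of _ 0])
  then show "{pt x, z} \<in> snd \<Gamma>"
    using assms d by (auto simp: edge_iff affine_points_eq rep_lines_eq)
qed

lemma edge_lin:
  assumes "w \<in> H" "d \<in> D"
  shows "{lin w d, z} \<in> snd \<Gamma> \<longleftrightarrow> (\<exists>t. z = pt (w + t *s d))"
proof
  assume "{lin w d, z} \<in> snd \<Gamma>"
  moreover have "lin w d \<in> rep_lines H K"
    using assms by (auto simp: rep_lines_eq)
  ultimately have "z \<in> affine_points H" "z \<subseteq> lin w d"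
    using disjoint by (auto simp: edge_iff)
  then obtain x where "x \<in> H" "z = pt x" "pt x \<subseteq> lin w d"
    by (auto simp: affine_points_eq)
  then show "\<exists>t. z = pt (w + t *s d)"
    using pt_subset_lin assms by blast
next
  assume "\<exists>t. z = pt (w + t *s d)"
  then obtain t where t: "z = pt (w + t *s d)"
    by blast
  have x: "w + t *s d \<in> H"
    using assms D_H H_add H_scale by blast
  then have "z \<subseteq> lin w d"
    using pt_subset_lin[OF x assms] t by blast
  then show "{lin w d, z} \<in> snd \<Gamma>"
    using assms x t by (auto simp: edge_iff affine_points_eq rep_lines_eq)
qed

text \<open>Reading walks as sums of multiples of directions turns the two clauses of
  \<open>far\<close> into the hypotheses of \<open>no_far_points\<close> for
  \<open>y - x\<close>.\<close>

lemma not_far_pt: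
  assumes "x \<in> H" "y \<in> H"
  shows "\<not> far \<Gamma> (pt x) (pt y)"
proof
  assume far: "far \<Gamma> (pt x) (pt y)"
  show False
  proof (rule no_far_points[of "y - x"])
    show "4 \<le> vec.dim H \<or> odd CARD('a)"
      by (rule four_or_odd)
    show "y - x \<noteq> t *s d" if d: "d \<in> D" for d t
    proof
      assume "y - x = t *s d"
      then have "y = x + t *s d"
        by (simp add: algebra_simps)
      then have "{pt x, lin x d} \<in> snd \<Gamma>" "{lin x d, pt y} \<in> snd \<Gamma>"
        using d assms by (auto simp: edge_pt edge_lin)
      then show False
        using far unfolding far_def by blast
    qed
    show "\<exists>e\<in>D. \<exists>t s. y - x = t *s d + s *s e" if d: "d \<in> D" for d
    proof -
      have "{pt x, lin x d} \<in> snd \<Gamma>"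
        using d assms by (auto simp: edge_pt)
      then obtain k l where kl: "{lin x d, k} \<in> snd \<Gamma>" "{k, l} \<in> snd \<Gamma>" "{l, pt y} \<in> snd \<Gamma>"
        using far unfolding far_def by blast
      obtain t where t: "k = pt (x + t *s d)"
        using kl(1) edge_lin[OF assms(1) d] by blast
      have xt: "x + t *s d \<in> H"
        using assms(1) d D_H H_add H_scale by blast
      obtain e where e: "e \<in> D" "l = lin (x + t *s d) e"
        using kl(2) t edge_pt[OF xt] by blast
      obtain s where s: "pt y = pt (x + t *s d + s *s e)"
        using kl(3) e edge_lin[OF xt e(1)] by blast
      have "y = x + t *s d + s *s e"
        using pt_inj[OF assms(2) _ s] xt e(1) D_H H_add H_scale by blast
      then have "y - x = t *s d + s *s e"
        by (simp add: algebra_simps)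
      then show ?thesis
        using e(1) by blast
    qed
  qed
qed

lemma far_lin_parallel:
  assumes w: "w \<in> H" "w' \<in> H" and d: "d \<in> D" "d' \<in> D" and far: "far \<Gamma> (lin w d) (lin w' d')"
  shows "d = d'"
proof (rule far_lines_parallel[OF d])
  have H: "w + t *s d \<in> H" "w' + t *s d' \<in> H" for t
    using w d D_H H_add H_scale by blast+
  show "w + t *s d \<noteq> w' + t' *s d'" for t t'
  proof
    assume eq: "w + t *s d = w' + t' *s d'"
    have "{lin w d, pt (w + t *s d)} \<in> snd \<Gamma>"
      using edge_lin[OF w(1) d(1)] by blast
    moreover have "{pt (w + t *s d), lin w' d'} \<in> snd \<Gamma>"
      unfolding eq insert_commute[of "pt (w' + t' *s d')"] using edge_lin[OF w(2) d(2)] by blast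
    ultimately show False
      using far unfolding far_def by blast
  qed
  show "\<exists>e\<in>D. \<exists>r t'. w + t *s d + r *s e = w' + t' *s d'" for t
  proof -
    have "{lin w d, pt (w + t *s d)} \<in> snd \<Gamma>"
      using w d by (auto simp: edge_lin)
    then obtain k y where ky: "{pt (w + t *s d), k} \<in> snd \<Gamma>" "{k, y} \<in> snd \<Gamma>"
      "{y, lin w' d'} \<in> snd \<Gamma>"
      using far unfolding far_def by blast
    obtain e where e: "e \<in> D" "k = lin (w + t *s d) e"
      using ky(1) edge_pt[OF H(1)] by blast
    obtain r where r: "y = pt (w + t *s d + r *s e)"
      using ky(2) e edge_lin[OF H(1) e(1)] by blast
    obtain t' where t': "y = pt (w' + t' *s d')"
      using ky(3) edge_lin[OF w(2) d(2)] by (auto simp: insert_commute)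
    have "w + t *s d + r *s e = w' + t' *s d'"
      by (rule pt_inj) (use r t' H e D_H H_add H_scale in auto)
    then show ?thesis
      using e(1) by blast
  qed
qed

text \<open>Each point of the first line reaches the second along a line of direction
  \<open>e\<close>, and independence of \<open>d\<close> and \<open>e\<close> excludes a common
  point. Such shifts suffice later, because every translation is a sum of them.\<close>

lemma far_lin:
  assumes w: "w \<in> H" and d: "d \<in> D" "e \<in> D" "d \<noteq> e" and s: "s \<noteq> 0"
  shows "far \<Gamma> (lin w d) (lin (w + s *s e) d)"
  unfolding far_def
proof (intro conjI allI impI notI)
  have H: "w + t *s e \<in> H" "w + t *s d \<in> H" for t
    using w d D_H H_add H_scale by blast+
  assume "\<exists>z. {lin w d, z} \<in> snd \<Gamma> \<and> {z, lin (w + s *s e) d} \<in> snd \<Gamma>"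
  then obtain z where z: "{lin w d, z} \<in> snd \<Gamma>" "{lin (w + s *s e) d, z} \<in> snd \<Gamma>"
    by (auto simp: insert_commute)
  obtain t where t: "z = pt (w + t *s d)"
    using z(1) edge_lin[OF w d(1)] by auto
  obtain t' where "z = pt (w + s *s e + t' *s d)"
    using z(2) edge_lin[OF H(1) d(1)] by auto
  with t have eq: "pt (w + t *s d) = pt (w + s *s e + t' *s d)"
    by simp
  have "w + t *s d = w + s *s e + t' *s d"
    by (rule pt_inj[OF H(2) H_add[OF H(1) H_scale[OF D_H[OF d(1)]]] eq])
  then have "(t' - t) *s d + s *s e = 0"
    by (simp add: vec.scale_left_diff_distrib algebra_simps)
  then show False
    using coeff_zero2(2)[OF d] s by blast
next
  have H: "w + t *s e \<in> H" "w + t *s d \<in> H" for t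
    using w d D_H H_add H_scale by blast+
  fix x assume "{lin w d, x} \<in> snd \<Gamma>"
  then obtain t where t: "x = pt (w + t *s d)"
    using edge_lin[OF w d(1)] by blast
  have eq: "w + t *s d + s *s e = w + s *s e + t *s d"
    by (simp add: algebra_simps)
  have "{x, lin (w + t *s d) e} \<in> snd \<Gamma>"
    using edge_pt[OF H(2)] d t by blast
  moreover have "{lin (w + t *s d) e, pt (w + t *s d + s *s e)} \<in> snd \<Gamma>"
    using edge_lin[OF H(2) d(2)] by blast
  moreover have "{pt (w + t *s d + s *s e), lin (w + s *s e) d} \<in> snd \<Gamma>"
    unfolding eq insert_commute[of "pt (w + s *s e + t *s d)"] using edge_lin[OF H(1) d(1)] by blast
  ultimately show "\<exists>k y. {x, k} \<in> snd \<Gamma> \<and> {k, y} \<in> snd \<Gamma> \<and> {y, lin (w + s *s e) d} \<in> snd \<Gamma>"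
    by blast
qed

section \<open>Automorphisms are induced by semilinear maps\<close>

lemma graph_Aut_iff:
  "\<alpha> \<in> carrier (graph_Aut \<Gamma>) \<longleftrightarrow>
    \<alpha> \<in> extensional (fst \<Gamma>) \<and> bij_betw \<alpha> (fst \<Gamma>) (fst \<Gamma>) \<and>
    (\<forall>u\<in>fst \<Gamma>. \<forall>v\<in>fst \<Gamma>. {\<alpha> u, \<alpha> v} \<in> snd \<Gamma> \<longleftrightarrow> {u, v} \<in> snd \<Gamma>)"
  by (auto simp: graph_Aut_def Bij_def)

lemma pt_vertex: "x \<in> H \<Longrightarrow> pt x \<in> fst \<Gamma>"
  and lin_vertex: "x \<in> H \<Longrightarrow> d \<in> D \<Longrightarrow> lin x d \<in> fst \<Gamma>"
  by (auto simp: vertices)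

lemma other_direction:
  assumes "d \<in> D"
  obtains e where "e \<in> D" "d \<noteq> e"
proof -
  have "\<not> D \<subseteq> {d}"
  proof
    assume "D \<subseteq> {d}"
    then have "card D \<le> card {d}"
      by (rule card_mono[rotated]) simp
    then show False
      using dim_less dim_ge by simp
  qed
  then show ?thesis
    using that by blast
qed

text \<open>A line is far from one of its translates. If its image were a point, the image of the
  translate could be neither a point, by \<open>not_far_pt\<close>, nor a line, since the walks
  would have the wrong parity.\<close>

lemma Aut_lin:
  assumes \<alpha>: "\<alpha> \<in> carrier (graph_Aut \<Gamma>)" and w: "w \<in> H" and d: "d \<in> D"
  shows "\<exists>w'\<in>H. \<exists>d'\<in>D. \<alpha> (lin w d) = lin w' d'"
proof -
  obtain e where e: "e \<in> D" "d \<noteq> e"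
    using other_direction[OF d] .
  have we: "w + 1 *s e \<in> H"
    using w e D_H H_add H_scale by blast
  have far: "far \<Gamma> (\<alpha> (lin w d)) (\<alpha> (lin (w + 1 *s e) d))"
    by (intro far_graph_Aut[OF \<alpha> edges_subset] lin_vertex far_lin w we d e) simp
  have V: "\<alpha> (lin w d) \<in> fst \<Gamma>" "\<alpha> (lin (w + 1 *s e) d) \<in> fst \<Gamma>"
    using \<alpha> lin_vertex[OF w d] lin_vertex[OF we d] unfolding graph_Aut_iff
    by (blast dest: bij_betwE)+
  show ?thesis
  proof (rule ccontr)
    assume "\<not> ?thesis"
    then obtain x where x: "x \<in> H" "\<alpha> (lin w d) = pt x"
      using V(1) unfolding vertices by blast
    from V(2) show False
      unfolding vertices
    proof
      assume "\<alpha> (lin (w + 1 *s e) d) \<in> pt ` H"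
      then show False
        using far not_far_pt x by auto
    next
      assume "\<alpha> (lin (w + 1 *s e) d) \<in> {lin w d | w d. w \<in> H \<and> d \<in> D}"
      then obtain y f where y: "y \<in> H" "f \<in> D" "\<alpha> (lin (w + 1 *s e) d) = lin y f"
        by blast
      \<comment> \<open>The image walk starts at a line through \<open>pt x\<close> and ends at a
        line; its two intermediate vertices would be adjacent affine points.\<close>
      obtain u where u: "u \<in> D"
        using d by blast
      have "{pt x, lin x u} \<in> snd \<Gamma>"
        using edge_pt[OF x(1)] u by blast
      then obtain k l where kl: "{lin x u, k} \<in> snd \<Gamma>" "{k, l} \<in> snd \<Gamma>" "{l, lin y f} \<in> snd \<Gamma>"
        using far x y unfolding far_def by metis
      have "l \<in> affine_points H"
        using kl(3) y(1,2) disjoint[of l] disjoint[of "lin y f"]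
        by (auto simp: edge_iff rep_lines_eq)
      moreover have "k \<in> affine_points H"
        using kl(1) x(1) u disjoint[of "lin x u"] by (auto simp: edge_iff rep_lines_eq)
      ultimately show False
        using kl(2) disjoint by (auto simp: edge_iff)
    qed
  qed
qed

text \<open>The finite set of lines is mapped injectively into itself, hence onto itself, which
  leaves no line as the image of a point.\<close>

lemma Aut_pt:
  assumes \<alpha>: "\<alpha> \<in> carrier (graph_Aut \<Gamma>)" and x: "x \<in> H"
  shows "\<exists>y\<in>H. \<alpha> (pt x) = pt y"
proof (rule ccontr)
  assume not_pt: "\<not> ?thesis"
  have bij: "bij_betw \<alpha> (fst \<Gamma>) (fst \<Gamma>)"
    using \<alpha> by (simp add: graph_Aut_iff)
  let ?L = "rep_lines H K"
  have L: "?L \<subseteq> fst \<Gamma>"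
    by (auto simp: Gamma_graph_def)
  have "\<alpha> ` ?L \<subseteq> ?L"
    using Aut_lin[OF \<alpha>] by (fastforce simp: rep_lines_eq)
  moreover have inj: "inj_on \<alpha> (fst \<Gamma>)"
    using bij by (simp add: bij_betw_def)
  ultimately have "\<alpha> ` ?L = ?L"
    using inj_on_subset[OF inj L] by (intro endo_inj_surj) auto
  moreover have "\<alpha> (pt x) \<in> ?L"
    using not_pt bij_betwE[OF bij] pt_vertex[OF x] unfolding vertices rep_lines_eq by blast
  ultimately obtain l where "l \<in> ?L" "\<alpha> (pt x) = \<alpha> l"
    by (metis imageE)
  then have "pt x \<in> ?L"
    using inj_onD[OF inj] L pt_vertex[OF x] by blast
  then show False
    using disjoint[of "pt x"] x by (simp add: affine_points_eq)
qed

lemma Aut_affine: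
  assumes \<alpha>: "\<alpha> \<in> carrier (graph_Aut \<Gamma>)"
  obtains \<phi> \<pi> where "\<And>x. x \<in> H \<Longrightarrow> \<phi> x \<in> H" "inj_on \<phi> H"
    "\<And>d. d \<in> D \<Longrightarrow> \<pi> d \<in> D" "inj_on \<pi> D"
    "\<And>x. x \<in> H \<Longrightarrow> \<alpha> (pt x) = pt (\<phi> x)"
    "\<And>x d. x \<in> H \<Longrightarrow> d \<in> D \<Longrightarrow> \<alpha> (lin x d) = lin (\<phi> x) (\<pi> d)"
    "\<And>x d t. x \<in> H \<Longrightarrow> d \<in> D \<Longrightarrow> \<exists>s. \<phi> (x + t *s d) = \<phi> x + s *s \<pi> d"
proof -
  have inj: "inj_on \<alpha> (fst \<Gamma>)"
    and adj: "\<And>u v. u \<in> fst \<Gamma> \<Longrightarrow> v \<in> fst \<Gamma> \<Longrightarrow> {\<alpha> u, \<alpha> v} \<in> snd \<Gamma> \<longleftrightarrow> {u, v} \<in> snd \<Gamma>"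
    using \<alpha> by (auto simp: graph_Aut_iff bij_betw_def)
  have H: "x + t *s d \<in> H" if "x \<in> H" "d \<in> D" for x t d
    using that D_H H_add H_scale by blast
  have "\<forall>x. \<exists>y. x \<in> H \<longrightarrow> y \<in> H \<and> \<alpha> (pt x) = pt y"
    using Aut_pt[OF \<alpha>] by blast
  then obtain \<phi> where \<phi>: "\<And>x. x \<in> H \<Longrightarrow> \<phi> x \<in> H" "\<And>x. x \<in> H \<Longrightarrow> \<alpha> (pt x) = pt (\<phi> x)"
    by metis
  have "\<exists>d'\<in>D. \<alpha> (lin x d) = lin (\<phi> x) d'" if xd: "x \<in> H" "d \<in> D" for x d
  proof -
    have "{pt x, lin x d} \<in> snd \<Gamma>"
      using edge_pt xd by blast
    then have "{pt (\<phi> x), \<alpha> (lin x d)} \<in> snd \<Gamma>"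
      using adj[OF pt_vertex lin_vertex] \<phi>(2) xd by metis
    then show ?thesis
      using edge_pt[OF \<phi>(1)] xd by blast
  qed
  then have "\<forall>x d. \<exists>d'. x \<in> H \<and> d \<in> D \<longrightarrow> d' \<in> D \<and> \<alpha> (lin x d) = lin (\<phi> x) d'"
    by blast
  then obtain \<delta> where \<delta>: "\<And>x d. x \<in> H \<Longrightarrow> d \<in> D \<Longrightarrow> \<delta> x d \<in> D"
    "\<And>x d. x \<in> H \<Longrightarrow> d \<in> D \<Longrightarrow> \<alpha> (lin x d) = lin (\<phi> x) (\<delta> x d)"
    by metis
  \<comment> \<open>Shifting along \<open>d\<close> leaves the line unchanged. A nonzero shift along
    another direction gives a far line, whose image is far and therefore parallel.\<close>
  have step: "\<delta> (x + s *s e) d = \<delta> x d" if x: "x \<in> H" and de: "d \<in> D" "e \<in> D" for x s d e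
  proof (cases "e = d \<or> s = 0")
    case True
    then have "lin (x + s *s e) d = lin x d"
      using lin_shift[OF x de(1)] by auto
    then have "lin (\<phi> (x + s *s e)) (\<delta> (x + s *s e) d) = lin (\<phi> x) (\<delta> x d)"
      using \<delta>(2)[OF H[OF x de(2), of s] de(1)] \<delta>(2)[OF x de(1)] by simp
    then show ?thesis
      by (intro lin_eq_dir[of "\<phi> (x + s *s e)" "\<phi> x"]) (auto intro: \<phi> \<delta> H x de)
  next
    case False
    then have "far \<Gamma> (\<alpha> (lin x d)) (\<alpha> (lin (x + s *s e) d))"
      by (intro far_graph_Aut[OF \<alpha> edges_subset] lin_vertex far_lin H x de) auto
    then have "far \<Gamma> (lin (\<phi> x) (\<delta> x d)) (lin (\<phi> (x + s *s e)) (\<delta> (x + s *s e) d))"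
      using \<delta>(2)[OF H[OF x de(2), of s] de(1)] \<delta>(2)[OF x de(1)] by simp
    then have "\<delta> x d = \<delta> (x + s *s e) d"
      by (rule far_lin_parallel[rotated 4]) (auto intro: \<phi> \<delta> H x de)
    then show ?thesis by simp
  qed
  \<comment> \<open>\<open>D\<close> spans \<open>H\<close>, so any two base points are joined by
    shifts along directions.\<close>
  have const: "\<delta> x d = \<delta> 0 d" if x: "x \<in> H" and d: "d \<in> D" for x d
  proof -
    have "x \<in> vec.span D"
      using span_eq[of D] dim_less x by simp
    then have "\<forall>y\<in>H. \<delta> (y + x) d = \<delta> y d"
    proof (induction x rule: vec.span_induct_alt)
      case base
      then show ?case by simp
    next
      case (step c e x)
      show ?case
      proof
        fix y assume y: "y \<in> H"
        have "\<delta> (y + c *s e + x) d = \<delta> (y + c *s e) d"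
          using step(2) H[OF y step(1)] by blast
        also have "\<dots> = \<delta> y d"
          by (rule \<open>\<And>x s d e. x \<in> H \<Longrightarrow> d \<in> D \<Longrightarrow> e \<in> D \<Longrightarrow> \<delta> (x + s *s e) d = \<delta> x d\<close>[OF y d step(1)])
        finally show "\<delta> (y + (c *s e + x)) d = \<delta> y d"
          by (simp add: add.assoc)
      qed
    qed
    then show ?thesis
      using H_zero by force
  qed
  show ?thesis
  proof (rule that[of \<phi> "\<delta> 0"])
    show "inj_on \<phi> H"
    proof (rule inj_onI)
      fix x y assume xy: "x \<in> H" "y \<in> H" "\<phi> x = \<phi> y"
      then have "\<alpha> (pt x) = \<alpha> (pt y)"
        using \<phi>(2) by simp
      then have "pt x = pt y"
        using inj_onD[OF inj] pt_vertex xy by blast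
      then show "x = y"
        using pt_inj xy by blast
    qed
    show "inj_on (\<delta> 0) D"
    proof (rule inj_onI)
      fix d e assume de: "d \<in> D" "e \<in> D" "\<delta> 0 d = \<delta> 0 e"
      then have "\<alpha> (lin 0 d) = \<alpha> (lin 0 e)"
        using \<delta>(2) H_zero by simp
      then have "lin 0 d = lin 0 e"
        using inj_onD[OF inj] lin_vertex[OF H_zero] de by blast
      then show "d = e"
        using lin_eq_dir[OF H_zero H_zero] de by blast
    qed
    show "\<alpha> (lin x d) = lin (\<phi> x) (\<delta> 0 d)" if "x \<in> H" "d \<in> D" for x d
      using \<delta>(2)[OF that] const[OF that] by simp
    show "\<exists>s. \<phi> (x + t *s d) = \<phi> x + s *s \<delta> 0 d" if xd: "x \<in> H" "d \<in> D" for x d t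
    proof -
      have "{lin x d, pt (x + t *s d)} \<in> snd \<Gamma>"
        using edge_lin xd by blast
      then have "{\<alpha> (lin x d), \<alpha> (pt (x + t *s d))} \<in> snd \<Gamma>"
        using adj[OF lin_vertex pt_vertex] H xd by blast
      then have "{lin (\<phi> x) (\<delta> 0 d), pt (\<phi> (x + t *s d))} \<in> snd \<Gamma>"
        using \<phi>(2)[OF H[OF xd]] \<delta>(2)[OF xd] const[OF xd] by simp
      then obtain s where "pt (\<phi> (x + t *s d)) = pt (\<phi> x + s *s \<delta> 0 d)"
        using edge_lin[OF \<phi>(1)[OF xd(1)] \<delta>(1)[OF H_zero xd(2)]] by blast
      then show ?thesis
        using pt_inj[OF \<phi>(1)[OF H[OF xd]] H[OF \<phi>(1)[OF xd(1)] \<delta>(1)[OF H_zero xd(2)]]] by blast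
    qed
  qed (use \<phi> \<delta> H_zero in auto)
qed

text \<open>The semilinear part of \<open>\<phi>\<close> is extended from \<open>H\<close> to the
  whole space by sending \<open>v0\<close> to \<open>v0 + \<phi> 0\<close>, which makes the
  extension send \<open>v0 + w\<close> to \<open>v0 + \<phi> w\<close>.\<close>

lemma Aut_semilinear:
  assumes \<alpha>: "\<alpha> \<in> carrier (graph_Aut \<Gamma>)"
  obtains \<sigma> f where "semilinear_bij \<sigma> f" "(\<lambda>P. f ` P) ` K = K" "\<And>X. X \<in> fst \<Gamma> \<Longrightarrow> \<alpha> X = f ` X"
proof -
  obtain \<phi> \<pi> where \<phi>: "\<And>x. x \<in> H \<Longrightarrow> \<phi> x \<in> H" "inj_on \<phi> H"
    and \<pi>: "\<And>d. d \<in> D \<Longrightarrow> \<pi> d \<in> D" "inj_on \<pi> D"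
    and \<alpha>_pt: "\<And>x. x \<in> H \<Longrightarrow> \<alpha> (pt x) = pt (\<phi> x)"
    and \<alpha>_lin: "\<And>x d. x \<in> H \<Longrightarrow> d \<in> D \<Longrightarrow> \<alpha> (lin x d) = lin (\<phi> x) (\<pi> d)"
    and line: "\<And>x d t. x \<in> H \<Longrightarrow> d \<in> D \<Longrightarrow> \<exists>s. \<phi> (x + t *s d) = \<phi> x + s *s \<pi> d"
    using Aut_affine[OF \<alpha>] by blast
  let ?g = "\<lambda>x. \<phi> x - \<phi> 0"
  obtain \<sigma> where \<sigma>: "field_aut \<sigma>" and g_scale: "\<And>c x. x \<in> H \<Longrightarrow> ?g (c *s x) = \<sigma> c *s ?g x"
    using semilinear_if_parallel[OF \<pi> line \<phi>(2) large] by blast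
  have \<sigma>_add: "\<sigma> (a + b) = \<sigma> a + \<sigma> b" and \<sigma>_mult: "\<sigma> (a * b) = \<sigma> a * \<sigma> b" for a b
    using \<sigma> by (auto simp: field_aut_def)
  have \<sigma>_0: "\<sigma> a = 0 \<longleftrightarrow> a = 0" for a
  proof -
    have "\<sigma> 0 + \<sigma> 0 = \<sigma> 0 + 0"
      using \<sigma>_add[of 0 0] by simp
    then have "\<sigma> 0 = 0"
      by (simp only: add_left_cancel)
    moreover have "inj \<sigma>"
      using \<sigma> by (simp add: field_aut_def bij_def)
    ultimately show ?thesis
      by (metis injD)
  qed
  have \<sigma>_1: "\<sigma> 1 = 1"
    using \<sigma>_mult[of 1 1] \<sigma>_0[of 1] by simp
  have g_add: "?g (x + y) = ?g x + ?g y" if "x \<in> H" "y \<in> H" for x y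
    using translation_invariant_if_parallel[of \<pi> \<phi>, OF \<pi> line that] by (simp add: algebra_simps)
  define \<rho> where "\<rho> = (\<lambda>u. u - \<kappa> u *s v0)"
  have \<rho>_H: "\<rho> u \<in> H" for u
    unfolding \<rho>_def by (rule \<kappa>_H)
  define f where "f = (\<lambda>u. ?g (\<rho> u) + \<sigma> (\<kappa> u) *s (v0 + \<phi> 0))"
  have f_add: "f (u + v) = f u + f v" for u v
  proof -
    have "\<rho> (u + v) = \<rho> u + \<rho> v"
      by (simp add: \<rho>_def \<kappa>_add vector_sadd_rdistrib)
    then have "f (u + v) = ?g (\<rho> u + \<rho> v) + \<sigma> (\<kappa> u + \<kappa> v) *s (v0 + \<phi> 0)"
      by (simp add: f_def \<kappa>_add)
    also have "\<dots> = ?g (\<rho> u) + ?g (\<rho> v) + (\<sigma> (\<kappa> u) + \<sigma> (\<kappa> v)) *s (v0 + \<phi> 0)"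
      by (simp only: g_add \<rho>_H \<sigma>_add)
    finally show ?thesis
      by (simp add: f_def vector_sadd_rdistrib)
  qed
  have f_scale: "f (c *s u) = \<sigma> c *s f u" for c u
  proof -
    have "\<rho> (c *s u) = c *s \<rho> u"
      by (simp add: \<rho>_def \<kappa>_scale vec.scale_right_diff_distrib vector_smult_assoc)
    then have "f (c *s u) = ?g (c *s \<rho> u) + \<sigma> (c * \<kappa> u) *s (v0 + \<phi> 0)"
      by (simp add: f_def \<kappa>_scale)
    also have "\<dots> = \<sigma> c *s ?g (\<rho> u) + (\<sigma> c * \<sigma> (\<kappa> u)) *s (v0 + \<phi> 0)"
      by (simp only: g_scale \<rho>_H \<sigma>_mult)
    also have "\<dots> = \<sigma> c *s f u"
      unfolding f_def vec.scale_right_distrib vector_smult_assoc by simp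
    finally show ?thesis .
  qed
  have \<rho>_id: "\<rho> w = w" "\<kappa> w = 0" if "w \<in> H" for w
    using that \<kappa>_eq_0[of w] by (simp_all add: \<rho>_def)
  have f_H: "f w = ?g w" if "w \<in> H" for w
    using \<rho>_id[OF that] \<sigma>_0[of 0] by (simp add: f_def)
  have f_v0: "f v0 = v0 + \<phi> 0"
    by (simp add: f_def \<rho>_def \<kappa>_v0 \<sigma>_1)
  have f_pt: "f (v0 + w) = v0 + \<phi> w" if "w \<in> H" for w
    using that by (simp add: f_add f_H f_v0)
  have "inj f"
  proof (rule injI)
    fix u v assume "f u = f v"
    then have "f (u - v) = 0"
      using f_add[of "u - v" v] by simp
    define x where "x = u - v"
    have 0: "f x = 0"
      using \<open>f (u - v) = 0\<close> by (simp add: x_def)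
    have gH: "?g (\<rho> x) \<in> H"
      using \<phi>(1) \<rho>_H H_diff H_zero by blast
    \<comment> \<open>The functional turns \<open>f\<close> into \<open>\<sigma>\<close> applied to
      \<open>\<kappa> x\<close>, so the kernel of \<open>f\<close> lies in \<open>H\<close>, where
      \<open>\<phi>\<close> is injective.\<close>
    have "\<kappa> (f x) = \<kappa> (?g (\<rho> x)) + \<sigma> (\<kappa> x) * \<kappa> (v0 + \<phi> 0)"
      unfolding f_def \<kappa>_add[of "?g (\<rho> x)"] \<kappa>_scale by simp
    then have "\<sigma> (\<kappa> x) = 0"
      using 0 gH \<kappa>_eq_0[of "?g (\<rho> x)"] \<kappa>_pt[OF \<phi>(1)[OF H_zero]] \<kappa>_eq_0[of 0] H_zero by simp
    then have xH: "x \<in> H"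
      using \<sigma>_0 \<kappa>_eq_0 by blast
    then have "\<phi> x = \<phi> 0"
      using 0 f_H by simp
    then have "x = 0"
      using inj_onD[OF \<phi>(2) _ xH H_zero] by blast
    then show "u = v"
      by (simp add: x_def)
  qed
  then have "bij f"
    by (simp add: bij_def finite_UNIV_inj_surj)
  then have semi: "semilinear_bij \<sigma> f"
    using \<sigma> f_add f_scale by (simp add: semilinear_bij_def)
  have f_dir: "\<exists>s. s \<noteq> 0 \<and> f d = s *s \<pi> d" if d: "d \<in> D" for d
  proof -
    obtain s where s: "\<phi> (0 + 1 *s d) = \<phi> 0 + s *s \<pi> d"
      using line[OF H_zero d] by blast
    then have fd: "f d = s *s \<pi> d"
      using f_H[OF D_H[OF d]] by simp
    have "f d \<noteq> f 0"
      using \<open>inj f\<close> nonzero[OF d] by (auto dest: injD)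
    moreover have "f 0 = 0"
      using f_add[of 0 0] by simp
    ultimately show ?thesis
      using fd by auto
  qed
  have f_point: "f ` vec.span {d} = vec.span {\<pi> d}" if "d \<in> D" for d
  proof -
    obtain s where "s \<noteq> 0" "f d = s *s \<pi> d"
      using f_dir[OF \<open>d \<in> D\<close>] by blast
    then show ?thesis
      using semilinear_image_span[OF semi, of "{d}"] span_singleton_scale[of s "\<pi> d"] by simp
  qed
  show ?thesis
  proof (rule that[OF semi])
    have "\<pi> ` D = D"
      using \<pi> by (intro endo_inj_surj) auto
    moreover have "(\<lambda>P. f ` P) ` K = (\<lambda>d. vec.span {d}) ` (\<pi> ` D)"
      using f_point unfolding K_eq by (auto simp: image_image intro!: image_cong)
    ultimately show "(\<lambda>P. f ` P) ` K = K"
      by (simp add: K_eq)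
    fix X assume "X \<in> fst \<Gamma>"
    then consider w where "w \<in> H" "X = pt w" | w d where "w \<in> H" "d \<in> D" "X = lin w d"
      unfolding vertices by blast
    then show "\<alpha> X = f ` X"
    proof cases
      case 1
      then show ?thesis
        using \<alpha>_pt semilinear_image_span[OF semi] f_pt by (simp add: pt_def)
    next
      case 2
      obtain s where s: "s \<noteq> 0" "f d = s *s \<pi> d"
        using f_dir[OF 2(2)] by blast
      \<comment> \<open>\<open>f d\<close> is only a nonzero multiple of \<open>\<pi> d\<close>, so
        the generator of the line has to be exchanged.\<close>
      have \<pi>d: "\<pi> d \<in> vec.span {s *s \<pi> d}"
        using span_singleton_scale[OF s(1), of "\<pi> d"] vec.span_base[of "\<pi> d" "{\<pi> d}"] by simp
      have "f ` X = vec.span {v0 + \<phi> w, s *s \<pi> d}"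
        using 2 semilinear_image_span[OF semi] f_pt s(2) by (simp add: lin_def)
      also have "\<dots> = vec.span {v0 + \<phi> w, \<pi> d}"
      proof
        show "vec.span {v0 + \<phi> w, s *s \<pi> d} \<subseteq> vec.span {v0 + \<phi> w, \<pi> d}"
          by (intro vec.span_minimal) (auto intro: vec.span_scale vec.span_base)
        show "vec.span {v0 + \<phi> w, \<pi> d} \<subseteq> vec.span {v0 + \<phi> w, s *s \<pi> d}"
          using \<pi>d vec.span_mono[of "{s *s \<pi> d}" "{v0 + \<phi> w, s *s \<pi> d}"]
          by (intro vec.span_minimal) (auto intro: vec.span_base)
      qed
      finally show ?thesis
        using \<alpha>_lin 2 by (simp add: lin_def)
    qed
  qed
qed

end

section \<open>The isomorphism\<close>

definition point_perm :: "('a::field ^ 'd::finite \<Rightarrow> 'a ^ 'd) \<Rightarrow> ('a ^ 'd) set \<Rightarrow> ('a ^ 'd) set" where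
  "point_perm f = (\<lambda>P\<in>pg_points UNIV. f ` P)"

text \<open>The action of a collineation on arbitrary subspaces, recovered from its action on points.\<close>

definition subspace_action ::
  "(('a::field ^ 'd::finite) set \<Rightarrow> ('a ^ 'd) set) \<Rightarrow> ('a ^ 'd) set \<Rightarrow> ('a ^ 'd) set" where
  "subspace_action g X = \<Union> (g ` pg_points X)"

lemma subspace_action_point_perm:
  assumes "vec.subspace X" "u \<in> X" "u \<noteq> 0"
  shows "subspace_action (point_perm f) X = f ` X"
proof -
  have "\<Union> (pg_points X) = X"
  proof
    show "\<Union> (pg_points X) \<subseteq> X"
      by (auto simp: pg_points_def)
    show "X \<subseteq> \<Union> (pg_points X)"
    proof
      fix x assume x: "x \<in> X"
      \<comment> \<open>The zero vector spans no point; it is covered by the point that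
        \<open>u\<close> spans.\<close>
      let ?y = "if x = 0 then u else x"
      have "vec.span {?y} \<in> pg_points X"
        using assms x by (intro pg_point_singleton) auto
      moreover have "x \<in> vec.span {?y}"
        by (auto simp: vec.span_zero intro: vec.span_base)
      ultimately show "x \<in> \<Union> (pg_points X)"
        by blast
    qed
  qed
  moreover have "point_perm f P = f ` P" if "P \<in> pg_points X" for P
    using that by (auto simp: point_perm_def pg_points_def)
  ultimately show ?thesis
    unfolding subspace_action_def by (metis (no_types, lifting) SUP_cong image_Union)
qed

lemma semilinear_0:
  assumes "semilinear_bij \<sigma> f"
  shows "f x = 0 \<longleftrightarrow> x = 0"
proof -
  have "f 0 + f 0 = f 0 + 0"
    using assms by (metis add.right_neutral semilinear_bij_def)
  then have "f 0 = 0"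
    by (simp only: add_left_cancel)
  then show ?thesis
    using assms by (metis bij_def injD semilinear_bij_def)
qed

lemma semilinear_pg_point:
  assumes "semilinear_bij \<sigma> f" "P \<in> pg_points UNIV"
  shows "f ` P \<in> pg_points UNIV"
proof -
  obtain u where u: "u \<noteq> 0" "P = vec.span {u}"
    using pg_point_obtain[OF assms(2)] by blast
  then have "f ` P = vec.span {f u}"
    using semilinear_image_span[OF assms(1), of "{u}"] by simp
  then show ?thesis
    using u(1) semilinear_0[OF assms(1)] pg_point_singleton[of "f u" UNIV] by simp
qed

lemma point_perm_Bij:
  fixes f :: "'a::{field,finite} ^ 'd::finite \<Rightarrow> 'a ^ 'd"
  assumes "semilinear_bij \<sigma> f"
  shows "point_perm f \<in> Bij (pg_points UNIV)"
proof -
  have "inj f"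
    using assms by (simp add: semilinear_bij_def bij_def)
  then have inj: "inj_on (point_perm f) (pg_points UNIV)"
    by (auto intro!: inj_onI simp: point_perm_def inj_image_eq_iff)
  moreover have "point_perm f ` pg_points UNIV = pg_points UNIV"
    using semilinear_pg_point[OF assms]
    by (intro endo_inj_surj[OF _ _ inj]) (auto simp: point_perm_def)
  ultimately show ?thesis
    by (simp add: Bij_def bij_betw_def point_perm_def)
qed

lemma point_perm_comp:
  assumes "semilinear_bij \<tau> g"
  shows "compose (pg_points UNIV) (point_perm f) (point_perm g) = point_perm (f \<circ> g)"
  using semilinear_pg_point[OF assms]
  unfolding compose_def point_perm_def by (intro restrict_ext) (simp add: image_comp)

context linear_rep
begin

section \<open>Collineations that stabilise \<open>K\<close>\<close>

definition stabilises :: "('a ^ 'd \<Rightarrow> 'a ^ 'd) \<Rightarrow> bool" where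
  "stabilises f \<longleftrightarrow> (\<exists>\<sigma>. semilinear_bij \<sigma> f) \<and> (\<lambda>P. f ` P) ` K = K"

lemma K_points: "K \<subseteq> pg_points UNIV"
  using nonzero pg_point_singleton[of _ UNIV] by (auto simp: K_eq)

lemma stabiliser_carrier: "carrier (PGammaL_stabiliser K) = point_perm ` {f. stabilises f}"
proof -
  have *: "(\<lambda>P. f ` P) ` K = point_perm f ` K" for f :: "'a ^ 'd \<Rightarrow> 'a ^ 'd"
    using K_points by (intro image_cong) (auto simp: point_perm_def)
  have "carrier (PGammaL_stabiliser K) =
      {g. (\<exists>f. g = point_perm f \<and> (\<exists>\<sigma>. semilinear_bij \<sigma> f)) \<and> g ` K = K}"
    by (auto simp: PGammaL_stabiliser_def PGammaL_def point_perm_def)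
  also have "\<dots> = point_perm ` {f. stabilises f}"
    by (rule Set.set_eqI) (auto simp only: stabilises_def * image_iff mem_Collect_eq)
  finally show ?thesis .
qed

lemma stabiliser_mult:
  assumes "stabilises f" "stabilises g"
  shows "point_perm f \<otimes>\<^bsub>PGammaL_stabiliser K\<^esub> point_perm g = point_perm (f \<circ> g)"
  using assms point_perm_Bij point_perm_comp
  by (auto simp: PGammaL_stabiliser_def PGammaL_def BijGroup_def stabilises_def)

lemma stabilises_comp:
  assumes "stabilises f" "stabilises g"
  shows "stabilises (f \<circ> g)"
proof -
  have "(\<lambda>P. (f \<circ> g) ` P) ` K = (\<lambda>P. f ` P) ` (\<lambda>P. g ` P) ` K"
    by (simp add: image_comp comp_def)
  then have "(\<lambda>P. (f \<circ> g) ` P) ` K = K"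
    using assms unfolding stabilises_def by metis
  moreover have "\<exists>\<sigma>. semilinear_bij \<sigma> (f \<circ> g)"
    using assms semilinear_bij_compose unfolding stabilises_def by metis
  ultimately show ?thesis
    unfolding stabilises_def by blast
qed

lemma stabilises_dir:
  assumes f: "stabilises f" and d: "d \<in> D"
  shows "\<exists>e\<in>D. vec.span {f d} = vec.span {e}"
proof -
  obtain \<sigma> where "semilinear_bij \<sigma> f"
    using f by (auto simp: stabilises_def)
  then have "f ` vec.span {d} = vec.span {f d}"
    using semilinear_image_span[of \<sigma> f "{d}"] by simp
  moreover have "f ` vec.span {d} \<in> K"
  proof -
    have "vec.span {d} \<in> K"
      using d by (simp add: K_eq)
    then show ?thesis
      using f unfolding stabilises_def by blast
  qed
  ultimately show ?thesis
    by (auto simp: K_eq)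
qed

text \<open>\<open>H\<close> is spanned by \<open>D\<close>, whose directions are permuted up to
  scalars. So \<open>f\<close> maps \<open>H\<close> into itself, and by finiteness onto
  itself.\<close>

lemma stabilises_H:
  assumes f: "stabilises f"
  shows "f x \<in> H \<longleftrightarrow> x \<in> H"
proof -
  obtain \<sigma> where \<sigma>: "semilinear_bij \<sigma> f"
    using f by (auto simp: stabilises_def)
  then have inj: "inj f"
    by (simp add: semilinear_bij_def bij_def)
  have "f d \<in> H" if "d \<in> D" for d
  proof -
    obtain e where e: "e \<in> D" "vec.span {f d} = vec.span {e}"
      using stabilises_dir[OF f \<open>d \<in> D\<close>] by blast
    have "vec.span {e} \<subseteq> H"
      using D_H[OF e(1)] by (intro vec.span_minimal subspace_H) auto
    then show ?thesis
      using e(2) vec.span_base[of "f d" "{f d}"] by auto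
  qed
  then have "vec.span (f ` D) \<subseteq> H"
    by (intro vec.span_minimal subspace_H) auto
  moreover have "f ` H = vec.span (f ` D)"
    using semilinear_image_span[OF \<sigma>, of D] span_eq[of D] dim_less by simp
  ultimately have "f ` H \<subseteq> H"
    by simp
  then have "f ` H = H"
    using inj by (intro endo_inj_surj) (auto intro: inj_on_subset)
  then show ?thesis
    using inj by (metis inj_image_mem_iff)
qed

lemma stabilises_affine_points:
  assumes f: "stabilises f" and X: "X \<in> affine_points H"
  shows "f ` X \<in> affine_points H"
proof -
  obtain \<sigma> where \<sigma>: "semilinear_bij \<sigma> f"
    using f by (auto simp: stabilises_def)
  obtain w where w: "w \<in> H" "X = vec.span {v0 + w}"
    using X by (auto simp: affine_points_eq pt_def)
  have "f (v0 + w) \<notin> H"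
    using stabilises_H[OF f] pt_notin_H[OF w(1)] by simp
  then show ?thesis
    using affine_point_span semilinear_image_span[OF \<sigma>, of "{v0 + w}"] w(2) by simp
qed

lemma stabilises_rep_lines:
  assumes f: "stabilises f" and X: "X \<in> rep_lines H K"
  shows "f ` X \<in> rep_lines H K"
proof -
  obtain \<sigma> where \<sigma>: "semilinear_bij \<sigma> f"
    using f by (auto simp: stabilises_def)
  obtain w d where w: "w \<in> H" "d \<in> D" "X = vec.span {v0 + w, d}"
    using X by (auto simp: rep_lines_eq lin_def)
  obtain e where e: "e \<in> D" "vec.span {f d} = vec.span {e}"
    using stabilises_dir[OF f w(2)] by blast
  have "vec.span {f (v0 + w), f d} = vec.span {f (v0 + w), e}"
    using e(2) vec.span_insert[of "f (v0 + w)" "{f d}"] vec.span_insert[of "f (v0 + w)" "{e}"]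
    by simp
  then have "f ` X = vec.span {f (v0 + w), e}"
    using semilinear_image_span[OF \<sigma>, of "{v0 + w, d}"] w(3) by simp
  moreover have "f (v0 + w) \<notin> H"
    using stabilises_H[OF f] pt_notin_H[OF w(1)] by simp
  then obtain w' where "w' \<in> H" "vec.span {f (v0 + w), e} = lin w' e"
    using rep_line_span e(1) by blast
  ultimately show ?thesis
    using e(1) unfolding rep_lines_eq by blast
qed

section \<open>The homomorphism onto the automorphism group\<close>

text \<open>The argument is a permutation of points and not a semilinear map, so no choice of a
  representative up to scalars is involved.\<close>

definition \<Theta> :: "(('a ^ 'd) set \<Rightarrow> ('a ^ 'd) set) \<Rightarrow> ('a ^ 'd) set \<Rightarrow> ('a ^ 'd) set" where
  "\<Theta> g = (\<lambda>X\<in>fst \<Gamma>. subspace_action g X)"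

lemma \<Theta>_point_perm:
  assumes "X \<in> fst \<Gamma>"
  shows "\<Theta> (point_perm f) X = f ` X"
proof -
  have "\<exists>w\<in>H. v0 + w \<in> X \<and> vec.subspace X"
    using assms vec.span_base[of "v0 + _" "{v0 + _}"] unfolding vertices
    by (auto simp: pt_def lin_def intro!: vec.span_base)
  then obtain w where w: "w \<in> H" "v0 + w \<in> X" "vec.subspace X"
    by blast
  have "v0 + w \<noteq> 0"
    using pt_notin_H[OF w(1)] H_zero by metis
  then show ?thesis
    using assms subspace_action_point_perm[OF w(3,2)] by (simp add: \<Theta>_def)
qed

lemma stabilises_vertex:
  assumes "stabilises f" "X \<in> fst \<Gamma>"
  shows "f ` X \<in> fst \<Gamma>"
  using assms stabilises_affine_points stabilises_rep_lines by (auto simp: Gamma_graph_def)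

lemma \<Theta>_Aut:
  assumes f: "stabilises f"
  shows "\<Theta> (point_perm f) \<in> carrier (graph_Aut \<Gamma>)"
proof -
  have inj: "inj f"
    using f by (auto simp: stabilises_def semilinear_bij_def bij_def)
  let ?t = "\<Theta> (point_perm f)"
  have inj_t: "inj_on ?t (fst \<Gamma>)"
    using inj by (auto intro!: inj_onI simp: \<Theta>_point_perm inj_image_eq_iff)
  have "?t ` fst \<Gamma> = fst \<Gamma>"
    using stabilises_vertex[OF f] by (intro endo_inj_surj inj_t) (auto simp: \<Theta>_point_perm)
  moreover have "{?t u, ?t v} \<in> snd \<Gamma> \<longleftrightarrow> {u, v} \<in> snd \<Gamma>" if uv: "u \<in> fst \<Gamma>" "v \<in> fst \<Gamma>" for u v
  proof -
    \<comment> \<open>The classes are disjoint and each is mapped into itself, which gives both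
      equivalences on vertices.\<close>
    have aff: "f ` X \<in> affine_points H \<longleftrightarrow> X \<in> affine_points H"
      and rep: "f ` X \<in> rep_lines H K \<longleftrightarrow> X \<in> rep_lines H K" if "X \<in> fst \<Gamma>" for X
      using that stabilises_affine_points[OF f, of X] stabilises_rep_lines[OF f, of X]
        disjoint[of X] disjoint[of "f ` X"] by (auto simp: Gamma_graph_def)
    show ?thesis
      using uv inj by (simp add: \<Theta>_point_perm edge_iff aff rep inj_image_subset_iff)
  qed
  ultimately show ?thesis
    using inj_t by (simp add: graph_Aut_iff bij_betw_def \<Theta>_def)
qed

lemma \<Theta>_mult:
  assumes f: "stabilises f" and g: "stabilises g"
  shows "\<Theta> (point_perm (f \<circ> g)) = \<Theta> (point_perm f) \<otimes>\<^bsub>graph_Aut \<Gamma>\<^esub> \<Theta> (point_perm g)"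
proof -
  have "\<Theta> (point_perm f) \<in> Bij (fst \<Gamma>)" "\<Theta> (point_perm g) \<in> Bij (fst \<Gamma>)"
    using \<Theta>_Aut f g by (auto simp: graph_Aut_def)
  then have "\<Theta> (point_perm f) \<otimes>\<^bsub>graph_Aut \<Gamma>\<^esub> \<Theta> (point_perm g)
      = compose (fst \<Gamma>) (\<Theta> (point_perm f)) (\<Theta> (point_perm g))"
    by (simp add: graph_Aut_def BijGroup_def)
  also have "\<dots> = \<Theta> (point_perm (f \<circ> g))"
  proof
    fix X
    show "compose (fst \<Gamma>) (\<Theta> (point_perm f)) (\<Theta> (point_perm g)) X = \<Theta> (point_perm (f \<circ> g)) X"
    proof (cases "X \<in> fst \<Gamma>")
      case True
      then show ?thesis
        using stabilises_vertex[OF g True]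
        by (simp add: compose_def \<Theta>_point_perm image_comp)
    next
      case False
      then show ?thesis
        by (simp add: compose_def \<Theta>_def)
    qed
  qed
  finally show ?thesis ..
qed

text \<open>Equal actions on vertices give agreement at affine points only. A point of
  \<open>H\<close> spanned by \<open>u\<close> is handled by comparing the images of the affine
  points spanned by \<open>v0\<close> and \<open>v0 + u\<close>.\<close>

lemma \<Theta>_inj:
  assumes f: "stabilises f" and g: "stabilises g"
    and eq: "\<Theta> (point_perm f) = \<Theta> (point_perm g)"
  shows "point_perm f = point_perm g"
proof -
  obtain \<sigma> \<tau> where semi: "semilinear_bij \<sigma> f" "semilinear_bij \<tau> g"
    using f g by (auto simp: stabilises_def)
  have add: "f (x + y) = f x + f y" "g (x + y) = g x + g y" for x y
    using semi by (auto simp: semilinear_bij_def)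
  have img: "f ` vec.span {u} = vec.span {f u}" "g ` vec.span {u} = vec.span {g u}" for u
    using semilinear_image_span[OF semi(1), of "{u}"] semilinear_image_span[OF semi(2), of "{u}"]
    by simp_all
  have aff: "vec.span {f u} = vec.span {g u}" if "u \<notin> H" for u
  proof -
    have "vec.span {u} \<in> fst \<Gamma>"
      using affine_point_span[OF that] by (simp add: Gamma_graph_def)
    then show ?thesis
      using eq \<Theta>_point_perm img by metis
  qed
  have "vec.span {f u} = vec.span {g u}" if u: "u \<noteq> 0" for u
  proof (cases "u \<in> H")
    case True
    have "f v0 \<in> vec.span {g v0}" "f (v0 + u) \<in> vec.span {g (v0 + u)}"
      using aff[OF v0] aff[OF pt_notin_H[OF True]] vec.span_base[of "f v0" "{f v0}"]
        vec.span_base[of "f (v0 + u)" "{f (v0 + u)}"] by simp_all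
    then obtain a b where a: "f v0 = a *s g v0" and b: "f (v0 + u) = b *s g (v0 + u)"
      by (auto simp: vec.span_singleton)
    have eq: "f u - b *s g u = (b - a) *s g v0"
      using a b by (simp add: add vec.scale_left_diff_distrib vec.scale_right_distrib algebra_simps)
    \<comment> \<open>The difference lies in \<open>H\<close> but is a multiple of
      \<open>g v0\<close>, which does not; hence the multiple is zero and the two scalars
      coincide.\<close>
    have "f u - b *s g u \<in> H"
      using True stabilises_H[OF f] stabilises_H[OF g] H_diff H_scale by blast
    then have "(b - a) *s g v0 \<in> H"
      using eq by simp
    moreover have "g v0 \<notin> H"
      using stabilises_H[OF g] v0 by simp
    ultimately have "b - a = 0"
      using vec.subspace_scale[OF subspace_H, of "(b - a) *s g v0" "1 / (b - a)"]
      by (cases "b - a = 0") (simp_all add: vector_smult_assoc)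
    then have fu: "f u = b *s g u"
      using eq by simp
    then have "b \<noteq> 0"
      using semilinear_0[OF semi(1), of u] u by (metis vec.scale_zero_left)
    then show ?thesis
      using fu span_singleton_scale by simp
  qed (rule aff)
  then have "f ` P = g ` P" if "P \<in> pg_points UNIV" for P
  proof -
    obtain u where "u \<noteq> 0" "P = vec.span {u}"
      using pg_point_obtain[OF \<open>P \<in> pg_points UNIV\<close>] by blast
    then show ?thesis
      using img \<open>\<And>u. u \<noteq> 0 \<Longrightarrow> vec.span {f u} = vec.span {g u}\<close> by simp
  qed
  then show ?thesis
    unfolding point_perm_def by (intro restrict_ext)
qed

theorem graph_Aut_iso: "graph_Aut \<Gamma> \<cong> PGammaL_stabiliser K"
proof (rule is_iso_if_inverse_iso)
  show "\<Theta> \<in> hom (PGammaL_stabiliser K) (graph_Aut \<Gamma>)"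
    by (rule homI) (auto simp: stabiliser_carrier \<Theta>_Aut stabiliser_mult \<Theta>_mult)
  show "bij_betw \<Theta> (carrier (PGammaL_stabiliser K)) (carrier (graph_Aut \<Gamma>))"
    unfolding bij_betw_def
  proof
    show "inj_on \<Theta> (carrier (PGammaL_stabiliser K))"
      using \<Theta>_inj by (auto intro!: inj_onI simp: stabiliser_carrier)
    show "\<Theta> ` carrier (PGammaL_stabiliser K) = carrier (graph_Aut \<Gamma>)"
    proof
      show "\<Theta> ` carrier (PGammaL_stabiliser K) \<subseteq> carrier (graph_Aut \<Gamma>)"
        using \<Theta>_Aut by (auto simp: stabiliser_carrier)
      show "carrier (graph_Aut \<Gamma>) \<subseteq> \<Theta> ` carrier (PGammaL_stabiliser K)"
      proof
        fix \<alpha> assume \<alpha>: "\<alpha> \<in> carrier (graph_Aut \<Gamma>)"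
        obtain \<sigma> f where f: "semilinear_bij \<sigma> f" "(\<lambda>P. f ` P) ` K = K"
          "\<And>X. X \<in> fst \<Gamma> \<Longrightarrow> \<alpha> X = f ` X"
          using Aut_semilinear[OF \<alpha>] by blast
        have "\<alpha> = \<Theta> (point_perm f)"
        proof (rule extensionalityI)
          show "\<alpha> \<in> extensional (fst \<Gamma>)"
            using \<alpha> by (simp add: graph_Aut_iff)
          show "\<Theta> (point_perm f) \<in> extensional (fst \<Gamma>)"
            by (simp add: \<Theta>_def)
        qed (simp add: f(3) \<Theta>_point_perm)
        then show "\<alpha> \<in> \<Theta> ` carrier (PGammaL_stabiliser K)"
          using f(1,2) by (auto simp: stabiliser_carrier stabilises_def)
      qed
    qed
  qed
  show "x \<otimes>\<^bsub>PGammaL_stabiliser K\<^esub> y \<in> carrier (PGammaL_stabiliser K)"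
    if "x \<in> carrier (PGammaL_stabiliser K)" "y \<in> carrier (PGammaL_stabiliser K)" for x y
    using that by (auto simp: stabiliser_carrier stabiliser_mult stabilises_comp)
qed

end

section \<open>From the arc of points to spanning vectors\<close>

theorem theorem3p5:
  fixes p h q n :: nat
    and H :: "('a::{field,finite} ^ 'd::finite) set"
    and K :: "('a ^ 'd) set set"
  assumes "prime p" and "h \<ge> 1" and "q = p ^ h" and "CARD('a) = q"
    and "n \<ge> 2" and "CARD('d) = n + 2"
    and "q \<ge> n + 3 \<or> (q = p \<and> p = n + 2)"
    and "n \<ge> 3 \<or> (n = 2 \<and> odd q)"
    and "H \<in> pg_hyperplanes UNIV"
    and "pg_arc H K" and "card K = q"
  shows "graph_Aut (Gamma_graph H K) \<cong> PGammaL_stabiliser K"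
proof -
  have H: "vec.subspace H" "vec.dim H = n + 1"
    using assms(6,9) by (auto simp: pg_hyperplanes_def vec_dim_card simp del: vec.dim_UNIV)
  have "vec.dim H \<noteq> vec.dim (UNIV :: ('a ^ 'd) set)"
    unfolding H(2) vec_dim_card assms(6) by simp
  then obtain v0 where v0: "v0 \<notin> H"
    by (metis UNIV_eq_I)
  have K: "K \<subseteq> pg_points H" "finite K"
    and arc: "\<And>S. S \<subseteq> K \<Longrightarrow> card S = vec.dim H \<Longrightarrow>
      \<not> (\<exists>W\<in>pg_hyperplanes H. \<forall>P\<in>S. P \<subseteq> W)"
    using assms(10) by (auto simp: pg_arc_def)
  \<comment> \<open>\<open>r\<close> chooses a spanning vector for each point of the arc; its values
    form the set of directions.\<close>
  have "\<forall>P. \<exists>u. P \<in> K \<longrightarrow> u \<noteq> 0 \<and> P = vec.span {u} \<and> u \<in> H"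
    using K(1) by (meson pg_point_obtain subsetD)
  then obtain r where r: "\<And>P. P \<in> K \<Longrightarrow> r P \<noteq> 0 \<and> P = vec.span {r P} \<and> r P \<in> H"
    by metis
  have inj_r: "inj_on r K"
    using r by (metis inj_onI)
  have "linear_rep H (r ` K) K v0"
  proof unfold_locales
    show "vec.subspace H" "v0 \<notin> H"
      using H(1) v0 by auto
    show "r ` K \<subseteq> H"
      using r by blast
    show card_D: "card (r ` K) = CARD('a)"
      using card_image[OF inj_r] assms(4,11) by simp
    \<comment> \<open>Both alternatives for q give q >= n + 2.\<close>
    show "vec.dim H < card (r ` K)"
      unfolding card_D H(2) assms(4) using assms(7) by auto
    show "3 \<le> vec.dim H"
      using H(2) assms(5) by simp
    \<comment> \<open>A dependent set of n + 1 directions would lie in a hyperplane of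
      \<open>H\<close>, and so would the corresponding points of the arc.\<close>
    show "vec.independent T" if T: "T \<subseteq> r ` K" "card T = vec.dim H" for T
    proof (rule ccontr)
      assume "\<not> vec.independent T"
      then obtain W where W: "W \<in> pg_hyperplanes H" "T \<subseteq> W"
        using hyperplane_if_dependent[OF H(1) _ T(2)] T(1) r by (metis image_subset_iff order_trans)
      obtain S where S: "S \<subseteq> K" "T = r ` S"
        using T(1) by (meson subset_imageE)
      have "card S = vec.dim H"
        using T(2) S card_image[OF inj_on_subset[OF inj_r S(1)]] by simp
      moreover have "P \<subseteq> W" if "P \<in> S" for P
      proof -
        have "vec.span {r P} \<subseteq> W"
          using W S(2) that by (intro vec.span_minimal) (auto simp: pg_hyperplanes_def)
        then show ?thesis
          using r S(1) that by auto
      qed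
      ultimately show False
        using arc[OF S(1)] W(1) by blast
    qed
    show "vec.dim H + 1 = CARD('d)"
      using H(2) assms(6) by simp
    show "K = (\<lambda>d. vec.span {d}) ` r ` K"
      using r by (auto simp: image_image image_iff)
    show "prime CARD('a) \<or> vec.dim H + 2 \<le> CARD('a)"
      using assms(1,4,7) H(2) by auto
    show "4 \<le> vec.dim H \<or> odd CARD('a)"
      using assms(4,8) H(2) by auto
  qed
  then show ?thesis
    by (rule linear_rep.graph_Aut_iso)
qed

end
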